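(* Let $\xi=\lim_{m\to\infty}\xi_m$ be the absolutely normal number produced by Schmidt's algorithm (as described in the context). For every integer base $r\ge 2$, the discrepancy of the sequence $(\{r^n\xi\})_{n\ge 1}$ satisfies $$D_N(\{r^n\xi\}) \ll \frac{\log\log N}{\log N},$$ i.e. there are a constant $C=C(r)>0$ and an $N_0=N_0(r)$, both allowed to depend on the base $r$, such that $D_N(\{r^n\xi\})\le C\,\frac{\log\log N}{\log N}$ for all $N\ge N_0$.
   Context: Notation. $\log$ is the natural logarithm, $e(x)=\exp(2\pi i x)$, $\lfloor x\rfloor$ and $\{x\}$ are the integer and fractional part. For integers $r,s\ge 2$, $r\sim s$ means that $r$ and $s$ are multiplicatively dependent (rational powers of each other), $r\not\sim s$ the negation. The discrepancy of a real sequence $(x_n)_{n\ge1}$ is $D_N(x_n)=\sup_{I}\left|\frac{\#\{1\le n\le N: x_n \bmod 1\in I\}}{N}-|I|\right|$, the supremum being over all subintervals $I\subset[0,1)$. A real number is absolutely normal if it is normal to every integer base $\ge2$. Constants $a_{20}(r,s)$. For integers $r,s>1$ with $r\not\sim s$, $a_{20}(r,s)>0$ denotes a fixed constant depending only on $r,s$ such that $\sum_{n=0}^{N-1}\prod_{k=K+1}^{\infty}|\cos(\pi r^n l/s^k)|\le 2N^{1-a_{20}(r,s)}$ for all positive integers $N,K,l$ with $l\ge s^K$ (such constants exist by a result of Schmidt). Sequences $R$ and $S$. Start with $R=(r_i)_{i\ge1}=\mathbb{N}_{\ge2}$ in increasing order and with a sequence $S=(s_j)_{j\ge1}$ of integers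 $s_j>2$ such that $s_m\le m s_1$ for all $m$ and such that for each $r\in R$ there is an index $m_0(r)$ with $r\not\sim s_m$ for all $m\ge m_0(r)$. Put $\beta_{i,j}=a_{20}(r_i,s_j)$ if $r_i\not\sim s_j$, chosen in $(0,\tfrac12)$ (and an arbitrary fixed number in $(0,\tfrac12)$ if $r_i\sim s_j$), $\beta_k=\min_{1\le i,j\le k}\beta_{i,j}$ and $\gamma_k=\max(r_1,\dots,r_k,s_1,\dots,s_k)$. Set $\phi(1)=1$ and for $k\ge2$ let $\phi(k)$ be the largest integer $\phi$ with $\phi\le\phi(k-1)+1$, $\beta_\phi\ge\beta_1/k^{1/4}$ and $\gamma_\phi\le\gamma_1k$. Replace the sequences by $r_i'=r_{\phi(i)}$, $s_i'=s_{\phi(i)}$. From now on $r_i,s_i,\beta_k,\gamma_k,m_0(r)$ refer to these modified sequences (with repetitions), so that $\beta_k\ge\beta_1/k^{1/4}$ and $\gamma_k\le\gamma_1k$. Symbols. For a positive integer $m$ and real $x>1$: $\langle m\rangle=\lfloor e^{\sqrt m}+2s_1m^3\rfloor$, $\langle m;x\rangle=\lfloor\langle m\rangle/\log x\rfloor$, $a_m=\langle m;s_m\rangle$, $b_m=\langle m+1;s_m\rangle$. Schmidt's algorithm. Put $\xi_0=0$. In step $m\ge1$, given $\xi_{m-1}$, let $\eta_m(\xi_{m-1})$ be the smallest of the numbers $g s_m^{-a_m}$, $g\in\mathbb{Z}$, with $\xi_{m-1}\le g s_m^{-a_m}$. Let $\sigma_m(\xi_{m-1})$ be the set of all numbers $\eta_m(\xi_{m-1})+c_{a_m+1}s_m^{-a_m-1}+\dots+c_{b_m-2}s_m^{-b_m+2}$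 with all $c_k\in\{0,1\}$. Let $\xi_m$ be the smallest among the elements $x$ of $\sigma_m(\xi_{m-1})$ that minimize $$A_m'(x)=\sum_{\substack{t=-m\\t\ne0}}^{m}\ \sum_{\substack{i\le m\\ m_0(r_i)\le m}}\left|\sum_{j=\langle m;r_i\rangle+1}^{\langle m+1;r_i\rangle}e(r_i^jtx)\right|^2 .$$ The sequence $(\xi_m)$ converges; its limit is $\xi$. *)

theory Defs
  imports "HOL-Analysis.Analysis"
begin

text \<open>All sequences below are indexed from 1; their values at index 0 play no role.\<close>

definition mult_dep :: "nat \<Rightarrow> nat \<Rightarrow> bool" where
  "mult_dep r s \<longleftrightarrow>
     (\<exists>q\<in>\<rat>. real r = real s powr q) \<and> (\<exists>q\<in>\<rat>. real s = real r powr q)"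

text \<open>The supremum is over all subintervals of \<open>[0,1)\<close>: open, closed, half-open or degenerate.\<close>

definition discrepancy :: "(nat \<Rightarrow> real) \<Rightarrow> nat \<Rightarrow> real" where
  "discrepancy x N =
     (SUP I\<in>{I. is_interval I \<and> I \<subseteq> {0..<1}}.
        \<bar>real (card {n\<in>{1..N}. frac (x n) \<in> I}) / real N - measure lborel I\<bar>)"

text \<open>\<open>schmidt_const r s a\<close>: the number \<open>a\<close> is admissible as the constant \<open>a\<^sub>2\<^sub>0(r,s)\<close>.
  The factor with index \<open>k\<close> of the infinite product here is the one with index
  \<open>K + 1 + k\<close> in the usual notation.\<close>

definition schmidt_const :: "nat \<Rightarrow> nat \<Rightarrow> real \<Rightarrow> bool" where
  "schmidt_const r s a \<longleftrightarrow> a > 0 \<and>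
     (\<forall>N K l. N > 0 \<longrightarrow> K > 0 \<longrightarrow> l > 0 \<longrightarrow> l \<ge> s ^ K \<longrightarrow>
        (\<Sum>n<N. \<Prod>k. \<bar>cos (pi * real r ^ n * real l / real s ^ (K + 1 + k))\<bar>)
          \<le> 2 * real N powr (1 - a))"

definition base_seq :: "nat \<Rightarrow> nat" where
  "base_seq i = i + 1"

definition beta_min :: "(nat \<Rightarrow> nat \<Rightarrow> real) \<Rightarrow> nat \<Rightarrow> real" where
  "beta_min \<beta> k = Min {\<beta> i j | i j. i \<in> {1..k} \<and> j \<in> {1..k}}"

definition gamma_max :: "(nat \<Rightarrow> nat) \<Rightarrow> nat \<Rightarrow> nat" where
  "gamma_max s k = Max (base_seq ` {1..k} \<union> s ` {1..k})"

primrec phi :: "(nat \<Rightarrow> nat) \<Rightarrow> (nat \<Rightarrow> nat \<Rightarrow> real) \<Rightarrow> nat \<Rightarrow> nat" where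
  "phi s \<beta> 0 = 0"
| "phi s \<beta> (Suc k) =
     (if k = 0 then 1
      else GREATEST p. 1 \<le> p \<and> p \<le> phi s \<beta> k + 1
             \<and> beta_min \<beta> p \<ge> beta_min \<beta> 1 / real (Suc k) powr (1 / 4)
             \<and> gamma_max s p \<le> gamma_max s 1 * Suc k)"

definition mod_r :: "(nat \<Rightarrow> nat) \<Rightarrow> (nat \<Rightarrow> nat \<Rightarrow> real) \<Rightarrow> nat \<Rightarrow> nat" where
  "mod_r s \<beta> i = base_seq (phi s \<beta> i)"

definition mod_s :: "(nat \<Rightarrow> nat) \<Rightarrow> (nat \<Rightarrow> nat \<Rightarrow> real) \<Rightarrow> nat \<Rightarrow> nat" where
  "mod_s s \<beta> i = s (phi s \<beta> i)"

text \<open>Here \<open>r\<close>, \<open>s\<close>, \<open>m0\<close> stand for the modified data. The notation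
  \<open>\<langle>m\<rangle>\<close> is rendered as \<open>ang s m\<close>, and \<open>\<langle>m;x\<rangle>\<close> as \<open>ang2 s m x\<close>; the sequence \<open>s\<close> enters
  only through \<open>s 1\<close>.\<close>

definition ang :: "(nat \<Rightarrow> nat) \<Rightarrow> nat \<Rightarrow> nat" where
  "ang s m = nat \<lfloor>exp (sqrt (real m)) + 2 * real (s 1) * real m ^ 3\<rfloor>"

definition ang2 :: "(nat \<Rightarrow> nat) \<Rightarrow> nat \<Rightarrow> real \<Rightarrow> nat" where
  "ang2 s m x = nat \<lfloor>real (ang s m) / ln x\<rfloor>"

definition a_ind :: "(nat \<Rightarrow> nat) \<Rightarrow> nat \<Rightarrow> nat" where
  "a_ind s m = ang2 s m (real (s m))"

definition b_ind :: "(nat \<Rightarrow> nat) \<Rightarrow> nat \<Rightarrow> nat" where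
  "b_ind s m = ang2 s (m + 1) (real (s m))"

definition eta :: "(nat \<Rightarrow> nat) \<Rightarrow> nat \<Rightarrow> real \<Rightarrow> real" where
  "eta s m x =
     (LEAST y. (\<exists>g::int. y = of_int g / real (s m) ^ a_ind s m) \<and> x \<le> y)"

definition sigma :: "(nat \<Rightarrow> nat) \<Rightarrow> nat \<Rightarrow> real \<Rightarrow> real set" where
  "sigma s m x =
     {eta s m x + (\<Sum>k = a_ind s m + 1..b_ind s m - 2. c k / real (s m) ^ k) | c.
        \<forall>k\<in>{a_ind s m + 1..b_ind s m - 2}. c k \<in> {0, 1}}"

definition unit_exp :: "real \<Rightarrow> complex" where
  "unit_exp x = exp (2 * of_real pi * \<i> * of_real x)"

definition A' :: "(nat \<Rightarrow> nat) \<Rightarrow> (nat \<Rightarrow> nat) \<Rightarrow> (nat \<Rightarrow> nat) \<Rightarrow> nat \<Rightarrow> real \<Rightarrow> real" where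
  "A' r s m0 m x =
     (\<Sum>t\<in>{- int m..int m} - {0}. \<Sum>i\<in>{i\<in>{1..m}. m0 (r i) \<le> m}.
        (cmod (\<Sum>j = ang2 s m (real (r i)) + 1..ang2 s (m + 1) (real (r i)).
           unit_exp (real (r i) ^ j * of_int t * x)))\<^sup>2)"

primrec schmidt_seq :: "(nat \<Rightarrow> nat) \<Rightarrow> (nat \<Rightarrow> nat) \<Rightarrow> (nat \<Rightarrow> nat) \<Rightarrow> nat \<Rightarrow> real" where
  "schmidt_seq r s m0 0 = 0"
| "schmidt_seq r s m0 (Suc m) =
     (LEAST x. x \<in> sigma s (Suc m) (schmidt_seq r s m0 m) \<and>
        (\<forall>y\<in>sigma s (Suc m) (schmidt_seq r s m0 m).
           A' r s m0 (Suc m) x \<le> A' r s m0 (Suc m) y))"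

definition schmidt_number :: "(nat \<Rightarrow> nat) \<Rightarrow> (nat \<Rightarrow> nat) \<Rightarrow> (nat \<Rightarrow> nat) \<Rightarrow> real" where
  "schmidt_number r s m0 = lim (schmidt_seq r s m0)"

end

theory Submission
  imports Defs "HOL-Real_Asymp.Real_Asymp"
begin

text \<open>
  The number \<open>\<xi>\<close> is built so that in every block of exponents \<open>\<langle>m;r\<rangle> < j \<le> \<langle>m+1;r\<rangle>\<close> the Weyl sums
  of \<open>r\<^sup>j \<xi>\<close> are very small. The candidates for \<open>\<xi>\<^sub>m\<close> form a Cantor-like set, all subset sums of a
  string of digits in base \<open>s\<^sub>m\<close>. The mean of an exponential over such a set is a product of cosines, so
  the mean square of a Weyl sum becomes a sum of cosine products over pairs of exponents, to which
  Schmidt's inequality applies (\<open>weyl_square_average_le\<close>). The minimizer is at most the mean. Since the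
  slowed-down exponent \<open>\<beta>\<^sub>m\<close> is at least a constant times \<open>m\<^sup>-\<^sup>1\<^sup>/\<^sup>4\<close>, and blocks have length at most a
  constant times \<open>exp \<surd>m\<close>, this saves, up to powers of \<open>m\<close>, a factor \<open>exp (- c m\<^sup>1\<^sup>/\<^sup>4)\<close> over the trivial
  bound, for all frequencies up to \<open>m\<close>. Passing from \<open>\<xi>\<^sub>m\<close> to \<open>\<xi>\<close> changes the Weyl sums by at most a
  constant times \<open>m\<^sup>2\<close>, because all later corrections together are at most a constant times
  \<open>m exp (- \<langle>m+1\<rangle>)\<close> (\<open>weyl_block_le\<close>).

  If \<open>N\<close> lies in the block number \<open>M\<close>, then \<open>\<surd>M\<close> has the order of \<open>log N\<close>. The part of that block below
  \<open>N\<close> has length at most a constant times \<open>N / \<surd>M\<close> and is discarded. For the complete blocks before it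
  all Weyl sums with frequency at most \<open>M / 4\<close> are negligible, even after multiplication with any
  power of \<open>M\<close>, so the Erdos-Turan inequality is needed only in a weak form, in which the Weyl sums
  enter with a factor of the size of the largest frequency instead of a logarithm
  (\<open>card_interval_le_weyl_sums\<close>). With frequencies up to \<open>M / 4\<close> it allows an error of order
  \<open>1 / \<surd>M\<close>. Altogether the discrepancy is \<open>O(1 / log N)\<close>, which implies the bound
  \<open>O(log log N / log N)\<close>.

  It remains to see that every base occurs among the modified bases: the reindexing \<open>\<phi>\<close> moves in steps
  of at most one and cannot stop (\<open>phi_surj\<close>).
\<close>

section \<open>Exponentials and geometric sums\<close>

lemma unit_exp_cis: "unit_exp x = cis (2 * pi * x)"
  by (simp add: unit_exp_def cis_conv_exp mult_ac)

lemma norm_unit_exp [simp]: "cmod (unit_exp x) = 1"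
  by (simp add: unit_exp_cis)

lemma unit_exp_0 [simp]: "unit_exp 0 = 1"
  by (simp add: unit_exp_cis)

lemma unit_exp_add: "unit_exp (x + y) = unit_exp x * unit_exp y"
  by (simp add: unit_exp_cis cis_mult distrib_left)

lemma unit_exp_diff: "unit_exp (x - y) = unit_exp x * cnj (unit_exp y)"
  by (simp add: unit_exp_cis cis_mult cis_cnj right_diff_distrib)

lemma unit_exp_sum: "unit_exp (\<Sum>k\<in>A. f k) = (\<Prod>k\<in>A. unit_exp (f k))"
  by (induction A rule: infinite_finite_induct) (auto simp: unit_exp_add)

lemma unit_exp_of_nat_mult: "unit_exp (real n * x) = unit_exp x ^ n"
  using Complex.DeMoivre[of "2 * pi * x" n] by (simp add: unit_exp_cis mult_ac)

lemma unit_exp_of_int [simp]: "unit_exp (of_int k) = 1"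
  using cis_multiple_2pi[of "of_int k"] by (simp add: unit_exp_cis)

lemma unit_exp_frac: "unit_exp (of_int h * frac x) = unit_exp (of_int h * x)"
proof -
  have "of_int h * x = of_int h * frac x + of_int (h * \<lfloor>x\<rfloor>)"
    by (simp add: frac_def algebra_simps)
  then show ?thesis by (simp only: unit_exp_add unit_exp_of_int) simp
qed

lemma norm_unit_exp_minus_1: "cmod (unit_exp y - 1) = 2 * \<bar>sin (pi * y)\<bar>"
proof -
  have "(cmod (unit_exp y - 1))\<^sup>2 = (cos (2 * pi * y) - 1)\<^sup>2 + (sin (2 * pi * y))\<^sup>2"
    by (simp add: unit_exp_cis cmod_power2)
  also have "\<dots> = 2 - 2 * cos (2 * pi * y)"
    using sin_cos_squared_add[of "2 * pi * y"] by (simp add: power2_eq_square algebra_simps)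
  also have "\<dots> = (2 * \<bar>sin (pi * y)\<bar>)\<^sup>2"
    using cos_double_sin[of "pi * y"] by (simp add: power_mult_distrib mult_ac)
  finally show ?thesis by (rule power2_eq_imp_eq) auto
qed

lemma norm_1_plus_unit_exp: "cmod (1 + unit_exp y) = 2 * \<bar>cos (pi * y)\<bar>"
proof -
  have "(cmod (1 + unit_exp y))\<^sup>2 = (1 + cos (2 * pi * y))\<^sup>2 + (sin (2 * pi * y))\<^sup>2"
    by (simp add: unit_exp_cis cmod_power2)
  also have "\<dots> = 2 + 2 * cos (2 * pi * y)"
    using sin_cos_squared_add[of "2 * pi * y"] by (simp add: power2_eq_square algebra_simps)
  also have "\<dots> = (2 * \<bar>cos (pi * y)\<bar>)\<^sup>2"
    using cos_double_cos[of "pi * y"] by (simp add: power_mult_distrib mult_ac)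
  finally show ?thesis by (rule power2_eq_imp_eq) auto
qed

lemma norm_sum_unit_exp_square:
  "of_real ((cmod (\<Sum>i\<in>A. unit_exp (f i)))\<^sup>2) =
     (\<Sum>i\<in>A. \<Sum>j\<in>A. unit_exp (f i - f j))"
proof -
  have "of_real ((cmod (\<Sum>i\<in>A. unit_exp (f i)))\<^sup>2) =
      (\<Sum>i\<in>A. unit_exp (f i)) * cnj (\<Sum>i\<in>A. unit_exp (f i))"
    by (rule complex_norm_square)
  then show ?thesis
    by (simp add: cnj_sum sum_product unit_exp_diff)
qed

lemma norm_unit_exp_diff_le: "cmod (unit_exp x - unit_exp y) \<le> 2 * pi * \<bar>x - y\<bar>"
proof -
  have "unit_exp x - unit_exp y = unit_exp y * (unit_exp (x - y) - 1)"
    using unit_exp_add[of y "x - y"] by (simp add: algebra_simps)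
  then have "cmod (unit_exp x - unit_exp y) = 2 * \<bar>sin (pi * (x - y))\<bar>"
    by (simp add: norm_mult norm_unit_exp_minus_1)
  also have "\<dots> \<le> 2 * \<bar>pi * (x - y)\<bar>"
    by (intro mult_left_mono abs_sin_x_le_abs_x) auto
  finally show ?thesis by (simp add: abs_mult)
qed

lemma sum_roots_of_unity:
  fixes h :: int and Q :: nat
  assumes "\<bar>h\<bar> < int Q"
  shows "(\<Sum>k<Q. unit_exp (of_int h * (real k / real Q))) = (if h = 0 then of_nat Q else 0)"
proof (cases "h = 0")
  case False
  define z where "z = unit_exp (of_int h / real Q)"
  have Q: "Q > 0" using assms by linarith
  have "z ^ Q = 1"
    using Q unit_exp_of_nat_mult[of Q "of_int h / real Q"] by (simp add: z_def)
  moreover have "z \<noteq> 1"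
  proof
    assume "z = 1"
    then have "sin (pi * (of_int h / real Q)) = 0"
      using norm_unit_exp_minus_1[of "of_int h / real Q"] by (simp add: z_def)
    then obtain i :: int where "pi * (of_int h / real Q) = of_int i * pi"
      by (auto simp: sin_zero_iff_int2)
    then have "of_int h = of_int i * real Q"
      using Q by (simp add: field_simps)
    then have "h = i * int Q"
      by (metis of_int_eq_iff of_int_mult of_int_of_nat_eq)
    then show False
      using assms False by (auto simp: abs_mult mult_less_cancel_right1)
  qed
  ultimately have "(\<Sum>k<Q. z ^ k) = 0"
    by (simp add: geometric_sum)
  moreover have "unit_exp (of_int h * (real k / real Q)) = z ^ k" for k
    using unit_exp_of_nat_mult[of k "of_int h / real Q"] by (simp add: z_def mult_ac)
  ultimately show ?thesis using False by simp
qed auto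

text \<open>On the circle the point \<open>y\<close> has distance at least \<open>\<delta>\<close> from \<open>0\<close>, so \<open>\<bar>e(y) - 1\<bar> \<ge> 2\<delta>\<close>, and the
  geometric sum is a quotient with this denominator and a numerator of modulus at most \<open>2\<close>.\<close>

lemma norm_geometric_unit_exp_le:
  assumes "0 < \<delta>" "\<delta> \<le> y" "y \<le> 1 - \<delta>"
  shows "cmod (\<Sum>n<P. unit_exp (real n * y)) \<le> 1 / \<delta>"
proof -
  \<comment> \<open>A substitute for Jordan's inequality: mean value theorem near \<open>0\<close>, monotonicity beyond \<open>1/6\<close>.\<close>
  have half: "z \<le> sin (pi * z)" if z: "0 \<le> z" "z \<le> 1 / 2" for z :: real
  proof (cases "z \<le> 1 / 6")
    case True
    show ?thesis
    proof (cases "z = 0")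
      case False
      then have "\<exists>c. 0 < c \<and> c < pi * z \<and> sin (pi * z) - sin 0 = (pi * z - 0) * cos c"
        using z by (intro MVT2) (auto intro!: derivative_eq_intros)
      then obtain c where c: "0 < c" "c < pi * z" "sin (pi * z) = pi * z * cos c" by auto
      have "c \<le> pi / 3"
      proof -
        have "pi * z \<le> pi * (1 / 3)"
          using True by (intro mult_left_mono) auto
        then show ?thesis using c by linarith
      qed
      then have "cos (pi / 3) \<le> cos c"
        using c by (intro cos_monotone_0_pi_le) auto
      then have "2 * z * (1 / 2) \<le> pi * z * cos c"
        using z pi_ge_two by (intro mult_mono) (auto simp: cos_60)
      then show ?thesis using c by simp
    qed auto
  next
    case False
    have "1 / 2 = sin (pi / 6)" by (simp add: sin_30)
    also have "\<dots> \<le> sin (pi * z)"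
      using False z by (intro sin_monotone_2pi_le) (auto simp: field_simps)
    finally show ?thesis using z by linarith
  qed
  have s: "\<delta> \<le> sin (pi * y)"
  proof (cases "y \<le> 1 / 2")
    case False
    then have "sin (pi * y) = sin (pi * (1 - y))"
      by (simp add: right_diff_distrib sin_diff)
    then show ?thesis using False half[of "1 - y"] assms by auto
  qed (use half[of y] assms in auto)
  then have ge: "cmod (unit_exp y - 1) \<ge> 2 * \<delta>"
    unfolding norm_unit_exp_minus_1 by linarith
  then have ne: "unit_exp y \<noteq> 1" using assms by auto
  have "(\<Sum>n<P. unit_exp (real n * y)) = (unit_exp y ^ P - 1) / (unit_exp y - 1)"
    using ne by (simp add: unit_exp_of_nat_mult geometric_sum)
  moreover have "cmod (unit_exp y ^ P - 1) \<le> 2"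
    using norm_triangle_ineq4[of "unit_exp y ^ P" 1] by (simp add: norm_power)
  ultimately have "cmod (\<Sum>n<P. unit_exp (real n * y)) \<le> 2 / (2 * \<delta>)"
    using ge assms by (simp only: norm_divide) (intro frac_le, auto)
  then show ?thesis by simp
qed

section \<open>A weak form of the Erdos-Turan inequality\<close>

text \<open>The fourth power of \<open>\<bar>\<Sum>n<P. e(n y)\<bar>\<close> serves as a kernel concentrated at \<open>0\<close>. As a trigonometric
  polynomial it is a sum over quadruples, and its decay \<open>y\<^sup>-\<^sup>4\<close> is fast enough to make every tail estimate
  below a crude supremum bound; the Fejer kernel, which decays like \<open>y\<^sup>-\<^sup>2\<close>, would not suffice for that.
  Averages over the grid of multiples of \<open>1/(2P)\<close> take the place of integrals.\<close>

definition quad_freq :: "(nat \<times> nat) \<times> (nat \<times> nat) \<Rightarrow> int" where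
  "quad_freq p = int (fst (fst p) + snd (fst p)) - int (fst (snd p) + snd (snd p))"

abbreviation quads :: "nat \<Rightarrow> ((nat \<times> nat) \<times> (nat \<times> nat)) set" where
  "quads P \<equiv> ({..<P} \<times> {..<P}) \<times> ({..<P} \<times> {..<P})"

definition kernel :: "nat \<Rightarrow> real \<Rightarrow> real" where
  "kernel P y = cmod (\<Sum>n<P. unit_exp (real n * y)) ^ 4"

text \<open>The constant Fourier coefficient of the kernel, that is, its integral over the circle.\<close>

definition kernel_mean :: "nat \<Rightarrow> nat" where
  "kernel_mean P = card {p\<in>quads P. quad_freq p = 0}"

lemma kernel_nonneg: "kernel P y \<ge> 0"
  by (simp add: kernel_def)

lemma kernel_expansion:
  "of_real (kernel P y) = (\<Sum>p\<in>quads P. unit_exp (of_int (quad_freq p) * y))"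
proof -
  have "kernel P y = (cmod ((\<Sum>n<P. unit_exp (real n * y)) * (\<Sum>n<P. unit_exp (real n * y))))\<^sup>2"
    by (simp add: kernel_def norm_mult power2_eq_square power4_eq_xxxx)
  also have "(\<Sum>n<P. unit_exp (real n * y)) * (\<Sum>n<P. unit_exp (real n * y)) =
      (\<Sum>p\<in>{..<P} \<times> {..<P}. unit_exp ((real (fst p) + real (snd p)) * y))"
    by (simp add: sum_product sum.cartesian_product unit_exp_add distrib_right case_prod_unfold)
  finally have "of_real (kernel P y) =
      (\<Sum>p\<in>{..<P} \<times> {..<P}. \<Sum>p'\<in>{..<P} \<times> {..<P}.
         unit_exp ((real (fst p) + real (snd p)) * y - (real (fst p') + real (snd p')) * y))"
    by (simp only: norm_sum_unit_exp_square)
  then show ?thesis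
    by (simp add: sum.cartesian_product quad_freq_def case_prod_unfold left_diff_distrib distrib_right)
qed

lemma quad_freq_bound:
  assumes "p \<in> quads P"
  shows "\<bar>quad_freq p\<bar> < int (2 * P)"
  using assms by (auto simp: quad_freq_def)

text \<open>All frequencies are smaller than \<open>2P\<close> in modulus, so a shifted grid with \<open>2P\<close> points integrates the
  kernel exactly.\<close>

lemma kernel_grid_sum:
  "(\<Sum>k<2 * P. kernel P ((of_int q0 + real k) / real (2 * P) - x)) = real (2 * P * kernel_mean P)"
proof -
  let ?Q = "2 * P"
  have shift: "of_int h * ((of_int q0 + real k) / real ?Q - x) =
      of_int h * (of_int q0 / real ?Q - x) + of_int h * (real k / real ?Q)" for h :: int and k
    by (simp add: add_divide_distrib algebra_simps)
  have "of_real (\<Sum>k<?Q. kernel P ((of_int q0 + real k) / real ?Q - x)) =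
      (\<Sum>k<?Q. \<Sum>p\<in>quads P. unit_exp (of_int (quad_freq p) * ((of_int q0 + real k) / real ?Q - x)))"
    by (simp add: kernel_expansion)
  also have "\<dots> = (\<Sum>p\<in>quads P. unit_exp (of_int (quad_freq p) * (of_int q0 / real ?Q - x)) *
      (\<Sum>k<?Q. unit_exp (of_int (quad_freq p) * (real k / real ?Q))))"
    by (subst sum.swap) (simp only: shift unit_exp_add sum_distrib_left)
  also have "\<dots> = (\<Sum>p\<in>quads P. if quad_freq p = 0 then of_nat ?Q else 0)"
    by (intro sum.cong refl, subst sum_roots_of_unity[OF quad_freq_bound]) auto
  also have "\<dots> = of_nat (?Q * kernel_mean P)"
    by (subst sum.If_cases) (auto simp: kernel_mean_def Int_def)
  finally show ?thesis
    by (metis of_real_eq_iff of_real_of_nat_eq)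
qed

text \<open>The grid average of the kernel equals its mean and is at least the contribution of the single point
  \<open>0\<close>, where the kernel is \<open>P\<^sup>4\<close>.\<close>

lemma kernel_mean_ge:
  assumes "P > 0"
  shows "real P ^ 3 \<le> 2 * real (kernel_mean P)"
proof -
  have "real P ^ 4 = kernel P ((of_int 0 + real 0) / real (2 * P) - 0)"
    by (simp add: kernel_def)
  also have "\<dots> \<le> (\<Sum>k<2 * P. kernel P ((of_int 0 + real k) / real (2 * P) - 0))"
    using assms by (intro member_le_sum) (auto simp: kernel_nonneg)
  also have "\<dots> = real P * (2 * real (kernel_mean P))"
    by (subst kernel_grid_sum) simp
  finally show ?thesis
    using assms by (simp add: power4_eq_xxxx power3_eq_cube)
qed

lemma kernel_le:
  assumes "0 < \<delta>" "\<delta> \<le> y" "y \<le> 1 - \<delta>"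
  shows "kernel P y \<le> 1 / \<delta> ^ 4"
  using power_mono[OF norm_geometric_unit_exp_le[OF assms, of P], of 4]
  by (simp add: kernel_def power_one_over)

lemma sum_kernel_le:
  assumes "finite A"
    and W: "\<And>h::int. h \<noteq> 0 \<Longrightarrow> \<bar>h\<bar> < int (2 * P) \<Longrightarrow> cmod (\<Sum>n\<in>A. unit_exp (of_int h * x n)) \<le> W"
    and "W \<ge> 0"
  shows "(\<Sum>n\<in>A. kernel P (y - x n)) \<le> real (kernel_mean P) * real (card A) + real P ^ 4 * W"
proof -
  let ?Z = "{p\<in>quads P. quad_freq p = 0}"
  have fin: "finite (quads P)" by simp
  have each: "cmod (\<Sum>n\<in>A. unit_exp (of_int (quad_freq p) * (y - x n))) \<le>
      (if quad_freq p = 0 then real (card A) else W)" if "p \<in> quads P" for p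
  proof (cases "quad_freq p = 0")
    case False
    have "of_int (quad_freq p) * (y - x n) =
        of_int (quad_freq p) * y + of_int (- quad_freq p) * x n" for n
      by (simp add: algebra_simps)
    then have "(\<Sum>n\<in>A. unit_exp (of_int (quad_freq p) * (y - x n))) =
        unit_exp (of_int (quad_freq p) * y) * (\<Sum>n\<in>A. unit_exp (of_int (- quad_freq p) * x n))"
      by (simp only: unit_exp_add sum_distrib_left)
    then show ?thesis
      using False W[of "- quad_freq p"] quad_freq_bound[OF that] by (simp add: norm_mult)
  qed simp
  have "(\<Sum>n\<in>A. kernel P (y - x n)) = cmod (of_real (\<Sum>n\<in>A. kernel P (y - x n)))"
    by (simp only: norm_of_real abs_of_nonneg sum_nonneg kernel_nonneg)
  also have "\<dots> = cmod (\<Sum>p\<in>quads P. \<Sum>n\<in>A. unit_exp (of_int (quad_freq p) * (y - x n)))"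
    by (subst sum.swap) (simp add: kernel_expansion)
  also have "\<dots> \<le> (\<Sum>p\<in>quads P. if quad_freq p = 0 then real (card A) else W)"
    by (intro sum_norm_le each)
  also have "\<dots> = real (kernel_mean P) * real (card A) + (\<Sum>p\<in>quads P - ?Z. W)"
  proof -
    have "quads P \<inter> - {p. quad_freq p = 0} = quads P - ?Z" by auto
    then show ?thesis
      using fin by (subst sum.If_cases) (auto simp: kernel_mean_def Int_def[of _ "Collect _"])
  qed
  also have "(\<Sum>p\<in>quads P - ?Z. W) \<le> (\<Sum>p\<in>quads P. W)"
    using fin assms by (intro sum_mono2) auto
  also have "\<dots> = real P ^ 4 * W"
    by (simp add: card_cartesian_product power4_eq_xxxx mult_ac)
  finally show ?thesis by simp
qed

text \<open>The indicator of \<open>[a, b]\<close> is compared with the sum of the kernel over the grid points within \<open>\<delta>\<close> of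
  \<open>[a, b]\<close>. At a point of \<open>[a, b]\<close> this sum lacks only terms at distance at least \<open>\<delta>\<close> from the peak;
  summed over all \<open>x\<^sub>n\<close>, each shifted kernel gives its mean plus Weyl sums.\<close>

lemma card_interval_le_weyl_sums:
  fixes x :: "nat \<Rightarrow> real"
  assumes A: "finite A" and P: "P > 0" and \<delta>: "\<delta> > 0" and ab: "a \<le> b"
    and W: "\<And>h::int. h \<noteq> 0 \<Longrightarrow> \<bar>h\<bar> < int (2 * P) \<Longrightarrow> cmod (\<Sum>n\<in>A. unit_exp (of_int h * x n)) \<le> W"
    and W0: "W \<ge> 0"
  shows "real (card {n\<in>A. x n \<in> {a..b}}) \<le>
     real (card A) * (b - a + 2 * \<delta> + 1 / real (2 * P)) + 2 * real P * W
       + 2 * real (card A) / (real P ^ 3 * \<delta> ^ 4)"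
proof -
  define Q where "Q = 2 * P"
  have Q: "Q > 0" using P by (simp add: Q_def)
  \<comment> \<open>The grid is run through once around the circle, starting at the left end of the enlarged
    interval; then every point of it outside \<open>S\<close> exceeds every \<open>x\<^sub>n \<in> [a, b]\<close> by an amount in \<open>[\<delta>, 1 - \<delta>]\<close>.\<close>
  define q0 where "q0 = \<lceil>real Q * (a - \<delta>)\<rceil>"
  define q where "q k = (of_int q0 + real k) / real Q" for k
  define S where "S = {k\<in>{..<Q}. q k \<le> b + \<delta>}"
  define c where "c = real (kernel_mean P)"
  have c: "real P ^ 3 \<le> 2 * c" using kernel_mean_ge[OF P] by (simp add: c_def)
  have c0: "c > 0" using c P by (smt (verit) of_nat_0_less_iff zero_less_power)
  have S: "finite S" "S \<subseteq> {..<Q}" by (auto simp: S_def)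
  have cardSQ: "card S \<le> Q" using card_mono[OF _ S(2)] by simp
  have cardS: "real (card S) \<le> real Q * (b - a + 2 * \<delta>) + 1"
  proof -
    have "S \<subseteq> {..<nat \<lfloor>real Q * (b - a + 2 * \<delta>) + 1\<rfloor>}"
    proof
      fix k assume "k \<in> S"
      then have "of_int q0 + real k \<le> real Q * (b + \<delta>)"
        using Q by (simp add: S_def q_def field_simps)
      moreover have "real Q * (a - \<delta>) \<le> of_int q0" by (simp add: q0_def)
      ultimately have "real k \<le> real Q * (b - a + 2 * \<delta>)" by (simp add: algebra_simps)
      then have "real k + 1 \<le> real Q * (b - a + 2 * \<delta>) + 1" by simp
      then have "int k + 1 \<le> \<lfloor>real Q * (b - a + 2 * \<delta>) + 1\<rfloor>" by (subst le_floor_iff) simp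
      then show "k \<in> {..<nat \<lfloor>real Q * (b - a + 2 * \<delta>) + 1\<rfloor>}"
        unfolding lessThan_iff by linarith
    qed
    then have "card S \<le> nat \<lfloor>real Q * (b - a + 2 * \<delta>) + 1\<rfloor>"
      using card_mono[OF finite_lessThan] by fastforce
    then have "real (card S) \<le> real (nat \<lfloor>real Q * (b - a + 2 * \<delta>) + 1\<rfloor>)" by simp
    also have "\<dots> \<le> real Q * (b - a + 2 * \<delta>) + 1"
      using ab \<delta> by (intro of_nat_floor) simp
    finally show ?thesis .
  qed
  have lower: "real Q * (c - 1 / \<delta> ^ 4) \<le> (\<Sum>k\<in>S. kernel P (q k - x n))" if "x n \<in> {a..b}" for n
  proof -
    have far: "kernel P (q k - x n) \<le> 1 / \<delta> ^ 4" if "k \<in> {..<Q} - S" for k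
    proof (rule kernel_le[OF \<delta>])
      show "\<delta> \<le> q k - x n" using that \<open>x n \<in> {a..b}\<close> by (auto simp: S_def)
      have "of_int q0 < real Q * (a - \<delta>) + 1" unfolding q0_def by linarith
      moreover have "real k + 1 \<le> real Q" using that by auto
      ultimately have "of_int q0 + real k \<le> real Q * (a - \<delta> + 1)"
        by (simp add: algebra_simps)
      then have "q k \<le> a - \<delta> + 1" using Q by (simp add: q_def divide_le_eq mult.commute)
      then show "q k - x n \<le> 1 - \<delta>" using \<open>x n \<in> {a..b}\<close> by auto
    qed
    have "real Q * c = (\<Sum>k<Q. kernel P (q k - x n))"
      using kernel_grid_sum[of P q0 "x n"] by (simp add: Q_def q_def c_def)
    also have "\<dots> = (\<Sum>k\<in>S. kernel P (q k - x n)) + (\<Sum>k\<in>{..<Q} - S. kernel P (q k - x n))"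
      using S by (subst sum.subset_diff[OF S(2)]) auto
    also have "(\<Sum>k\<in>{..<Q} - S. kernel P (q k - x n)) \<le> real (card ({..<Q} - S)) * (1 / \<delta> ^ 4)"
      using far by (intro sum_bounded_above)
    also have "real (card ({..<Q} - S)) * (1 / \<delta> ^ 4) \<le> real Q * (1 / \<delta> ^ 4)"
      using \<delta> card_mono[of "{..<Q}" "{..<Q} - S"] by (intro mult_right_mono) auto
    finally show ?thesis by (simp add: algebra_simps)
  qed
  let ?C = "{n\<in>A. x n \<in> {a..b}}"
  have "real (card ?C) * (real Q * (c - 1 / \<delta> ^ 4)) \<le> (\<Sum>n\<in>?C. \<Sum>k\<in>S. kernel P (q k - x n))"
    using lower by (intro sum_bounded_below) auto
  also have "\<dots> \<le> (\<Sum>n\<in>A. \<Sum>k\<in>S. kernel P (q k - x n))"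
    using A by (intro sum_mono2) (auto intro: sum_nonneg kernel_nonneg)
  also have "\<dots> = (\<Sum>k\<in>S. \<Sum>n\<in>A. kernel P (q k - x n))"
    by (rule sum.swap)
  also have "\<dots> \<le> real (card S) * (c * real (card A) + real P ^ 4 * W)"
    unfolding c_def by (intro sum_bounded_above sum_kernel_le A W W0)
  also have "\<dots> = real (card S) * c * real (card A) + real (card S) * (real P ^ 4 * W)"
    by (simp add: algebra_simps)
  also have "\<dots> \<le> (real Q * (b - a + 2 * \<delta>) + 1) * c * real (card A) + real Q * (real P ^ 4 * W)"
    using cardS cardSQ c0 W0 by (intro add_mono mult_right_mono) auto
  also have "real Q * (b - a + 2 * \<delta>) + 1 = real Q * (b - a + 2 * \<delta> + 1 / real Q)"
    using Q by (simp add: distrib_left)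
  finally have "real Q * (real (card ?C) * (c - 1 / \<delta> ^ 4)) \<le>
      real Q * ((b - a + 2 * \<delta> + 1 / real Q) * c * real (card A) + real P ^ 4 * W)"
    by (simp only: algebra_simps)
  then have "real (card ?C) * (c - 1 / \<delta> ^ 4) \<le>
      (b - a + 2 * \<delta> + 1 / real Q) * c * real (card A) + real P ^ 4 * W"
    using Q by simp
  then have "real (card ?C) * c \<le>
      (b - a + 2 * \<delta> + 1 / real Q) * c * real (card A) + real P ^ 4 * W + real (card ?C) / \<delta> ^ 4"
    by (simp add: algebra_simps)
  also have "real (card ?C) / \<delta> ^ 4 \<le> real (card A) / \<delta> ^ 4"
    using A \<delta> by (intro divide_right_mono) (auto intro!: card_mono)
  also have "real P ^ 4 * W \<le> c * (2 * real P * W)"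
    using mult_right_mono[OF c, of "real P * W"] W0 by (simp add: power4_eq_xxxx power3_eq_cube mult_ac)
  also have "real (card A) / \<delta> ^ 4 \<le> c * (2 * real (card A) / (real P ^ 3 * \<delta> ^ 4))"
    using mult_right_mono[OF c, of "real (card A) / (real P ^ 3 * \<delta> ^ 4)"] P \<delta>
    by (simp add: field_simps)
  finally have "c * real (card ?C) \<le> c * (real (card A) * (b - a + 2 * \<delta> + 1 / real Q) + 2 * real P * W
       + 2 * real (card A) / (real P ^ 3 * \<delta> ^ 4))"
    by (simp add: algebra_simps)
  then show ?thesis using c0 by (simp add: Q_def)
qed

lemma interval_endpoints:
  fixes I :: "real set"
  assumes "is_interval I" "I \<subseteq> {0..<1}" "I \<noteq> {}"
  obtains a b where "0 \<le> a" "a \<le> b" "b \<le> 1" "I \<subseteq> {a..b}" "{a<..<b} \<subseteq> I" "measure lborel I = b - a"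
proof -
  define a b where "a = Inf I" and "b = Sup I"
  have bdd: "bdd_below I" "bdd_above I"
    using assms(2) by (auto intro!: bdd_belowI[of _ 0] bdd_aboveI[of _ 1])
  have sub: "I \<subseteq> {a..b}"
    using bdd by (auto simp: a_def b_def cInf_lower cSup_upper)
  have sup: "{a<..<b} \<subseteq> I"
  proof
    fix z assume "z \<in> {a<..<b}"
    then obtain u v where "u \<in> I" "u < z" "v \<in> I" "z < v"
      using cInf_lessD[OF assms(3), of z] less_cSupD[OF assms(3), of z] by (auto simp: a_def b_def)
    then show "z \<in> I" using assms(1) unfolding is_interval_1 by (meson less_imp_le)
  qed
  have "0 \<le> a" "b \<le> 1"
    unfolding a_def b_def using assms by (auto intro!: cInf_greatest cSup_least)
  moreover have "a \<le> b" using sub assms(3) by auto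
  moreover have "measure lborel I = b - a"
  proof -
    have "I = {a<..<b} \<union> (I \<inter> {a, b})" using sub sup by fastforce
    then have meas: "I \<in> sets lborel"
      by (metis borel_open finite.emptyI finite.insertI finite_Int finite_imp_closed borel_closed
          open_greaterThanLessThan sets.Un sets_lborel)
    have fm: "{a..b} \<in> fmeasurable lborel" by (simp add: fmeasurable_def emeasure_lborel_Icc_eq)
    have "I \<in> fmeasurable lborel" using fmeasurableI2[OF fm sub meas] .
    then have "measure lborel {a<..<b} \<le> measure lborel I" "measure lborel I \<le> measure lborel {a..b}"
      using sub sup meas fm by (auto intro!: measure_mono_fmeasurable simp del: measure_lborel_Icc content_real_if)
    then show ?thesis using \<open>a \<le> b\<close> by simp
  qed
  ultimately show ?thesis using that sub sup by blast
qed

text \<open>Upper bounds suffice: a lower bound for an interval follows from upper bounds for the two intervals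
  that make up its complement.\<close>

lemma discrepancy_le_one_sided:
  fixes x :: "nat \<Rightarrow> real"
  assumes x: "\<And>n. x n \<in> {0..<1}" and N: "N > 0"
    and upper: "\<And>a b. 0 \<le> a \<Longrightarrow> a \<le> b \<Longrightarrow> b \<le> 1 \<Longrightarrow>
      real (card {n\<in>{1..N}. x n \<in> {a..b}}) \<le> real N * (b - a) + R"
  shows "discrepancy x N \<le> 2 * R / real N"
proof -
  have "{n\<in>{1..N}. x n \<in> {0..1}} = {1..N}" using x by (auto simp: less_imp_le)
  then have R: "R \<ge> 0" using upper[of 0 1] by simp
  have fr: "frac (x n) = x n" for n using x[of n] by (simp add: frac_eq)
  have "\<bar>real (card {n\<in>{1..N}. x n \<in> I}) / real N - measure lborel I\<bar> \<le> 2 * R / real N"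
    if I: "is_interval I" "I \<subseteq> {0..<1}" for I
  proof (cases "I = {}")
    case False
    obtain a b where ab: "0 \<le> a" "a \<le> b" "b \<le> 1" "I \<subseteq> {a..b}" "{a<..<b} \<subseteq> I"
      "measure lborel I = b - a"
      using interval_endpoints[OF I False] .
    let ?c = "\<lambda>J. card {n\<in>{1..N}. x n \<in> J}"
    have "real (?c I) \<le> real (?c {a..b})"
      using ab by (intro of_nat_mono card_mono) auto
    also have "\<dots> \<le> real N * (b - a) + R" using ab by (intro upper)
    finally have 1: "real (?c I) \<le> real N * (b - a) + 2 * R" using R by simp
    have "{1..N} \<subseteq> {n\<in>{1..N}. x n \<in> I} \<union> {n\<in>{1..N}. x n \<in> {0..a}} \<union> {n\<in>{1..N}. x n \<in> {b..1}}"
      using ab x by (force simp: subset_iff less_imp_le not_less)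
    then have "card {1..N} \<le> card ({n\<in>{1..N}. x n \<in> I} \<union> {n\<in>{1..N}. x n \<in> {0..a}} \<union> {n\<in>{1..N}. x n \<in> {b..1}})"
      by (intro card_mono) auto
    also have "\<dots> \<le> ?c I + ?c {0..a} + ?c {b..1}"
      by (meson card_Un_le le_trans add_le_mono1)
    finally have "real N \<le> real (?c I) + real (?c {0..a}) + real (?c {b..1})" by simp
    also have "\<dots> \<le> real (?c I) + (real N * (a - 0) + R) + (real N * (1 - b) + R)"
      using ab by (intro add_mono upper order_refl) auto
    finally have 2: "real N * (b - a) - 2 * R \<le> real (?c I)" by (simp add: algebra_simps)
    have "\<bar>real (?c I) - real N * (b - a)\<bar> \<le> 2 * R" using 1 2 by linarith
    moreover have "real (?c I) / real N - (b - a) = (real (?c I) - real N * (b - a)) / real N"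
      using N by (simp add: field_simps)
    ultimately show ?thesis using N ab by (simp add: abs_divide divide_right_mono)
  qed (use R in simp)
  then show ?thesis
    unfolding discrepancy_def fr by (intro cSUP_least) (auto intro!: exI[of _ "{}"])
qed

section \<open>Average Weyl sums over a Cantor set\<close>

lemma one_minus_abs_cos_le: "1 - \<bar>cos y\<bar> \<le> y\<^sup>2" for y :: real
proof -
  have "\<bar>cos y\<bar> * \<bar>cos y\<bar> \<le> 1 * \<bar>cos y\<bar>"
    by (intro mult_right_mono) auto
  then have "(cos y)\<^sup>2 \<le> \<bar>cos y\<bar>" by (simp add: power2_eq_square)
  then have "1 - \<bar>cos y\<bar> \<le> (sin y)\<^sup>2"
    using sin_cos_squared_add[of y] by linarith
  also have "\<dots> \<le> y\<^sup>2"
    using power_mono[OF abs_sin_x_le_abs_x[of y], of 2] by simp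
  finally show ?thesis .
qed

lemma convergent_prod_abs_cos:
  fixes D s :: real
  assumes "s > 1"
  shows "convergent_prod (\<lambda>k. \<bar>cos (pi * D / s ^ (a + 1 + k))\<bar>)"
proof -
  have "summable (\<lambda>k. (pi * D / s ^ (a + 1))\<^sup>2 * (1 / s\<^sup>2) ^ k)"
    using assms by (intro summable_mult summable_geometric) (auto simp: power2_eq_square less_1_mult)
  then have "summable (\<lambda>k. norm (\<bar>cos (pi * D / s ^ (a + 1 + k))\<bar> - 1))"
  proof (rule summable_comparison_test'[where N = 0])
    fix k
    have "norm (norm (\<bar>cos (pi * D / s ^ (a + 1 + k))\<bar> - 1)) = 1 - \<bar>cos (pi * D / s ^ (a + 1 + k))\<bar>"
      using abs_cos_le_one[of "pi * D / s ^ (a + 1 + k)"] by (simp del: abs_cos_le_one)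
    also have "\<dots> \<le> (pi * D / s ^ (a + 1 + k))\<^sup>2" by (rule one_minus_abs_cos_le)
    also have "\<dots> = (pi * D / s ^ (a + 1))\<^sup>2 * (1 / s\<^sup>2) ^ k"
      by (simp add: power_add power_divide power_mult_distrib power_even_eq power_commutes flip: power_mult)
    finally show "norm (norm (\<bar>cos (pi * D / s ^ (a + 1 + k))\<bar> - 1)) \<le>
        (pi * D / s ^ (a + 1))\<^sup>2 * (1 / s\<^sup>2) ^ k" .
  qed
  then show ?thesis
    using abs_convergent_prod_conv_summable abs_convergent_prod_imp_convergent_prod by blast
qed

lemma prodinf_abs_cos_nonneg:
  fixes D s :: real
  assumes "s > 1"
  shows "(\<Prod>k. \<bar>cos (pi * D / s ^ (a + 1 + k))\<bar>) \<ge> 0"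
  using convergent_prod_LIMSEQ[OF convergent_prod_abs_cos[OF assms]]
  by (rule LIMSEQ_le_const) (auto intro!: exI[of _ 0] prod_nonneg)

text \<open>Schmidt's inequality concerns infinite products. The factors beyond the digits at the disposal of the
  construction have arguments \<open>\<pi> D / s\<^sup>k\<close> decaying geometrically from at most \<open>\<pi>/9\<close>, so their product
  is at least \<open>1/2\<close>.\<close>

lemma finite_cos_product_le:
  fixes D s :: real
  assumes s: "s \<ge> 3" and D: "D \<ge> 0" "D * s ^ 3 \<le> s ^ b"
  shows "(\<Prod>k = a + 1..b - 2. \<bar>cos (pi * D / s ^ k)\<bar>) \<le> 2 * (\<Prod>k. \<bar>cos (pi * D / s ^ (a + 1 + k))\<bar>)"
proof -
  define f where "f k = \<bar>cos (pi * D / s ^ (a + 1 + k))\<bar>" for k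
  define n where "n = b - 2 - a"
  have s0: "s > 0" "s > 1" using s by auto
  have head: "(\<Prod>k = a + 1..b - 2. \<bar>cos (pi * D / s ^ k)\<bar>) = prod f {..<n}"
    unfolding f_def
    by (rule prod.reindex_bij_witness[of _ "\<lambda>k. a + 1 + k" "\<lambda>k. k - (a + 1)"]) (auto simp: n_def)
  have split: "prod f {..<n + M} = prod f {..<n} * (\<Prod>i<M. f (n + i))" for M
    by (induction M) (auto simp: mult_ac)
  have small: "1 - f (n + i) \<le> 16 / 81 * (1 / 9) ^ i" for i
  proof -
    have "s ^ b \<le> s ^ (a + 2 + n)"
      using s by (intro power_increasing) (auto simp: n_def)
    with D have "D * s ^ 3 \<le> s ^ (a + 2 + n)" by linarith
    then have "D / s ^ (a + 1 + (n + i)) \<le> s ^ (a + 2 + n) / s ^ 3 / s ^ (a + 1 + (n + i))"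
      using s0 by (intro divide_right_mono) (auto simp: le_divide_eq)
    also have "\<dots> = 1 / s ^ 2 * (1 / s ^ i)"
      using s0 by (simp add: power_add field_simps power2_eq_square power3_eq_cube)
    also have "\<dots> \<le> 1 / 3 ^ 2 * (1 / 3 ^ i)"
      using s by (intro mult_mono divide_left_mono power_mono) auto
    finally have "D / s ^ (a + 1 + (n + i)) \<le> 1 / 9 * (1 / 3) ^ i"
      by (simp add: power_one_over)
    then have "pi * (D / s ^ (a + 1 + (n + i))) \<le> 4 * (1 / 9 * (1 / 3) ^ i)"
      using D s0 pi_less_4 by (intro mult_mono) auto
    then have "(pi * D / s ^ (a + 1 + (n + i)))\<^sup>2 \<le> (4 / 9 * (1 / 3) ^ i)\<^sup>2"
      using D s0 by (intro power_mono) auto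
    also have "\<dots> = 16 / 81 * (1 / 9) ^ i"
      by (simp add: power_mult_distrib power_divide power_even_eq flip: power_mult)
         (simp add: mult.commute[of _ 2] power_mult)
    finally show ?thesis
      unfolding f_def using one_minus_abs_cos_le[of "pi * D / s ^ (a + 1 + (n + i))"] by linarith
  qed
  have tail: "(\<Prod>i<M. f (n + i)) \<ge> 1 / 2" for M
  proof -
    have "(\<Sum>i<M. 1 - f (n + i)) \<le> (\<Sum>i<M. 16 / 81 * (1 / 9) ^ i)"
      by (intro sum_mono small)
    also have "\<dots> = 16 / 81 * ((1 - (1 / 9) ^ M) / (1 - 1 / 9))"
      unfolding sum_distrib_left [symmetric] by (simp add: sum_gp_strict)
    also have "\<dots> \<le> 16 / 81 * (1 / (1 - 1 / 9))"
      by (intro mult_left_mono divide_right_mono) auto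
    also have "\<dots> \<le> 1 / 2" by simp
    finally have "1 / 2 \<le> 1 - (\<Sum>i<M. 1 - f (n + i))" by simp
    also have "\<dots> \<le> (\<Prod>i<M. 1 - (1 - f (n + i)))"
      by (intro Weierstrass_prod_ineq) (auto simp: f_def)
    finally show ?thesis by simp
  qed
  have "(\<lambda>M. prod f {..<M}) \<longlonglongrightarrow> prodinf f"
    using convergent_prod_LIMSEQ[OF convergent_prod_abs_cos[OF s0(2), of D a]]
    by (simp add: LIMSEQ_lessThan_iff_atMost f_def [abs_def])
  then have "(\<lambda>M. prod f {..<M + n}) \<longlonglongrightarrow> prodinf f"
    by (rule LIMSEQ_ignore_initial_segment)
  moreover have "prod f {..<M + n} \<ge> prod f {..<n} * (1 / 2)" for M
    using split[of M] mult_left_mono[OF tail[of M], of "prod f {..<n}"]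
    by (simp add: add.commute prod_nonneg f_def)
  ultimately have "prod f {..<n} * (1 / 2) \<le> prodinf f"
    by (intro LIMSEQ_le_const) auto
  then show ?thesis unfolding head by (simp add: f_def [abs_def])
qed

text \<open>Each digit is \<open>0\<close> or \<open>1\<close> independently, so the exponential sum over the Cantor set factorizes.\<close>

lemma norm_sum_unit_exp_subset_sums:
  assumes "finite K"
  shows "cmod (\<Sum>T\<in>Pow K. unit_exp (D * (\<eta> + (\<Sum>k\<in>T. y k)))) = 2 ^ card K * (\<Prod>k\<in>K. \<bar>cos (pi * (D * y k))\<bar>)"
proof -
  have "(\<Sum>T\<in>Pow K. unit_exp (D * (\<eta> + (\<Sum>k\<in>T. y k)))) =
      unit_exp (D * \<eta>) * (\<Sum>T\<in>Pow K. (\<Prod>k\<in>T. unit_exp (D * y k)) * (\<Prod>k\<in>K - T. 1))"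
    by (simp add: distrib_left unit_exp_add sum_distrib_left unit_exp_sum)
  also have "\<dots> = unit_exp (D * \<eta>) * (\<Prod>k\<in>K. unit_exp (D * y k) + 1)"
    using prod_add[OF assms, of "\<lambda>k. unit_exp (D * y k)" "\<lambda>_. 1"] by simp
  finally show ?thesis
    using norm_1_plus_unit_exp
    by (simp add: norm_mult prod_norm [symmetric] add.commute prod.distrib)
qed

text \<open>Pairs of exponents with difference \<open>g\<close> are parametrized by \<open>n\<close> through
  \<open>r\<^sup>i - r\<^sup>j = r\<^sup>n \<cdot> r\<^sup>A\<^sup>+\<^sup>1 (r\<^sup>g - 1)\<close>, so that for each \<open>g\<close> Schmidt's inequality bounds the sum over \<open>n\<close> and
  saves the factor \<open>L\<^sup>-\<^sup>\<alpha>\<close>, where \<open>L = B - A\<close>. The diagonal, and the few exponents so large that the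
  finite and the infinite product are not comparable, are estimated trivially.\<close>

lemma cos_product_pair_sum_le:
  fixes r s t a b A B :: nat and \<alpha> :: real
  assumes r: "r \<ge> 2" and s: "s \<ge> 3" and t: "t \<ge> 1" and a: "a \<ge> 1"
    and sc: "schmidt_const r s \<alpha>" and \<alpha>: "\<alpha> \<le> 1"
    and lo: "s ^ a \<le> r ^ (A + 1)" and hi: "r ^ B < s ^ (b + 1)"
  shows "(\<Sum>i\<in>{A + 1..B}. \<Sum>j\<in>{A + 1..B}.
            \<Prod>k = a + 1..b - 2. \<bar>cos (pi * ((real r ^ i - real r ^ j) * real t / real s ^ k))\<bar>)
         \<le> (2 * real t * real s ^ 4 + 9) * real (B - A) powr (2 - \<alpha>)"
proof (cases "A < B")
  case True
  define L where "L = B - A"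
  define J where "J = {A + 1..B}"
  define p where "p i j = (\<Prod>k = a + 1..b - 2. \<bar>cos (pi * ((real r ^ i - real r ^ j) * real t / real s ^ k))\<bar>)" for i j
  define l where "l g = r ^ (A + 1) * (r ^ g - 1) * t" for g
  define F where "F g n = (\<Prod>k. \<bar>cos (pi * real r ^ n * real (l g) / real s ^ (a + 1 + k))\<bar>)" for g n
  \<comment> \<open>For a bad exponent the tail of the infinite product may vanish.\<close>
  define bad where "bad j \<longleftrightarrow> s ^ b < r ^ j * t * s ^ 3" for j
  define E where "E = t * s ^ 4"
  define G where "G i j = (if j < i then F (i - j) (j - (A + 1)) else 0)" for i j
  have J: "finite J" "card J = L" using True by (auto simp: J_def L_def)
  have L: "L > 0" using True by (simp add: L_def)
  have F0: "F g n \<ge> 0" for g n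
    using prodinf_abs_cos_nonneg[of "real s" "real r ^ n * real (l g)" a] s by (simp add: F_def mult.assoc)
  then have G0: "G i j \<ge> 0" for i j by (simp add: G_def)
  have p1: "p i j \<le> 1" for i j
    by (auto simp: p_def intro: prod_le_1)
  have psym: "p i j = p j i" for i j
  proof -
    have "cos (pi * ((real r ^ i - real r ^ j) * real t / real s ^ k)) =
        cos (pi * ((real r ^ j - real r ^ i) * real t / real s ^ k))" for k
      by (subst cos_minus [symmetric]) (simp add: algebra_simps diff_divide_distrib)
    then show ?thesis by (simp add: p_def)
  qed
  have pF: "p i j \<le> 2 * G i j" if "i \<in> J" "j \<in> J" "j < i" "\<not> bad i" for i j
  proof -
    define D where "D = (real r ^ i - real r ^ j) * real t"
    have "real r ^ i = real r ^ (j - (A + 1)) * real r ^ (A + 1) * real r ^ (i - j)"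
      unfolding power_add [symmetric] using that by (intro arg_cong[where f = "(^) (real r)"]) (auto simp: J_def)
    moreover have "real r ^ j = real r ^ (j - (A + 1)) * real r ^ (A + 1)"
      unfolding power_add [symmetric] using that by (intro arg_cong[where f = "(^) (real r)"]) (auto simp: J_def)
    moreover have "real (r ^ (i - j) - 1) = real r ^ (i - j) - 1"
      using r by (subst of_nat_diff) auto
    ultimately have D: "D = real r ^ (j - (A + 1)) * real (l (i - j))"
      unfolding D_def l_def by (simp only: of_nat_mult of_nat_power) (simp only: algebra_simps)
    have "real (r ^ i * t * s ^ 3) \<le> real (s ^ b)"
      using that unfolding bad_def by (intro of_nat_mono) simp
    moreover have "D * real s ^ 3 \<le> (real r ^ i * real t) * real s ^ 3"
      unfolding D_def by (intro mult_right_mono) auto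
    ultimately have "D * real s ^ 3 \<le> real s ^ b" by simp
    moreover have "D \<ge> 0" unfolding D by simp
    ultimately have "(\<Prod>k = a + 1..b - 2. \<bar>cos (pi * D / real s ^ k)\<bar>) \<le>
        2 * (\<Prod>k. \<bar>cos (pi * D / real s ^ (a + 1 + k))\<bar>)"
      using s by (intro finite_cos_product_le) auto
    then have "p i j \<le> 2 * (\<Prod>k. \<bar>cos (pi * D / real s ^ (a + 1 + k))\<bar>)"
      by (simp add: p_def D_def mult.assoc)
    then show ?thesis using that by (simp add: D G_def F_def mult.assoc)
  qed
  have pointwise: "p i j \<le> of_bool (i = j) + of_bool (bad i) + of_bool (bad j) + 2 * G i j + 2 * G j i"
    if "i \<in> J" "j \<in> J" for i j
    using pF[of i j] pF[of j i] that p1[of i j] psym[of i j] G0[of i j] G0[of j i]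
    by (cases i j rule: linorder_cases) (auto simp: of_bool_def)
  have cardbad: "card {j\<in>J. bad j} \<le> E"
  proof -
    have "B - j < E" if "j \<in> J" "bad j" for j
    proof -
      have "r ^ B < s ^ b * s" using hi by (simp add: mult.commute)
      also have "\<dots> \<le> r ^ j * t * s ^ 3 * s" using that unfolding bad_def by (intro mult_right_mono) auto
      also have "\<dots> = r ^ j * E" by (simp add: E_def power4_eq_xxxx power3_eq_cube)
      also have "r ^ B = r ^ j * r ^ (B - j)"
        using that by (simp add: J_def flip: power_add)
      finally have "r ^ (B - j) < E" by simp
      moreover have "B - j < r ^ (B - j)"
        using less_exp[of "B - j"] power_mono[OF r, of "B - j"] by linarith
      ultimately show ?thesis by linarith
    qed
    then have "card {j\<in>J. bad j} \<le> card {..<E}"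
      by (intro card_inj_on_le[of "\<lambda>j. B - j"]) (auto simp: inj_on_def J_def)
    then show ?thesis by simp
  qed
  have Fsum: "(\<Sum>n<L. F g n) \<le> 2 * real L powr (1 - \<alpha>)" if "g \<in> {1..L}" for g
  proof -
    have "1 \<le> (r ^ g - 1) * t"
    proof -
      have "2 ^ g \<le> r ^ g" using r by (intro power_mono) auto
      moreover have "(2::nat) ^ 1 \<le> 2 ^ g" using that by (intro power_increasing) auto
      ultimately have "r ^ g - 1 \<ge> 1" by simp
      then show ?thesis using t by simp
    qed
    then have "s ^ a * 1 \<le> r ^ (A + 1) * ((r ^ g - 1) * t)"
      using lo by (intro mult_mono) auto
    then have l: "s ^ a \<le> l g" by (simp add: l_def mult.assoc)
    moreover have "0 < s ^ a" using s by simp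
    ultimately have "l g > 0" by linarith
    then show ?thesis
      using sc l L a unfolding schmidt_const_def F_def by simp
  qed
  have Gsum: "(\<Sum>i\<in>J. \<Sum>j\<in>J. G i j) \<le> 2 * real L powr (2 - \<alpha>)"
  proof -
    let ?X = "{q\<in>J \<times> J. snd q < fst q}"
    let ?h = "\<lambda>q. (fst q - snd q, snd q - (A + 1))"
    have "(\<Sum>i\<in>J. \<Sum>j\<in>J. G i j) = (\<Sum>q\<in>J \<times> J. if snd q < fst q then F (fst (?h q)) (snd (?h q)) else 0)"
      by (simp add: sum.cartesian_product G_def case_prod_unfold cong: if_cong)
    also have "\<dots> = (\<Sum>q\<in>?X. (\<lambda>u. F (fst u) (snd u)) (?h q))"
      using J by (subst sum.inter_filter) auto
    also have "\<dots> = (\<Sum>u\<in>?h ` ?X. F (fst u) (snd u))"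
      by (subst sum.reindex) (auto simp: inj_on_def J_def)
    also have "\<dots> \<le> (\<Sum>u\<in>{1..L} \<times> {..<L}. F (fst u) (snd u))"
      using F0 by (intro sum_mono2) (auto simp: J_def L_def)
    also have "\<dots> = (\<Sum>g\<in>{1..L}. \<Sum>n<L. F g n)"
      by (simp add: sum.cartesian_product case_prod_unfold)
    also have "\<dots> \<le> real (card {1..L}) * (2 * real L powr (1 - \<alpha>))"
      by (intro sum_bounded_above Fsum)
    also have "\<dots> = 2 * real L powr (2 - \<alpha>)"
      using L powr_mult_base[of "real L" "1 - \<alpha>"] by simp
    finally show ?thesis .
  qed
  have "(\<Sum>i\<in>J. \<Sum>j\<in>J. p i j) \<le>
      (\<Sum>i\<in>J. \<Sum>j\<in>J. of_bool (i = j) + of_bool (bad i) + of_bool (bad j) + 2 * G i j + 2 * G j i)"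
    by (intro sum_mono pointwise)
  also have "\<dots> = real L + 2 * real L * real (card {j\<in>J. bad j}) + 4 * (\<Sum>i\<in>J. \<Sum>j\<in>J. G i j)"
  proof -
    have "(\<Sum>i\<in>J. \<Sum>j\<in>J. of_bool (i = j) :: real) = real L"
      using J by (simp add: of_bool_def)
    moreover have "(\<Sum>j\<in>J. of_bool (bad j) :: real) = real (card {j\<in>J. bad j})"
      using J by (simp add: of_bool_def sum.inter_filter [symmetric])
    moreover have "(\<Sum>i\<in>J. \<Sum>j\<in>J. G j i) = (\<Sum>i\<in>J. \<Sum>j\<in>J. G i j)"
      by (rule sum.swap)
    ultimately show ?thesis
      using J by (simp add: sum.distrib flip: sum_distrib_left)
  qed
  also have "\<dots> \<le> real L + 2 * real L * real E + 4 * (2 * real L powr (2 - \<alpha>))"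
    using cardbad Gsum by (intro add_mono mult_left_mono) auto
  also have "\<dots> \<le> real L powr (2 - \<alpha>) + 2 * real L powr (2 - \<alpha>) * real E + 4 * (2 * real L powr (2 - \<alpha>))"
  proof -
    have "real L powr 1 \<le> real L powr (2 - \<alpha>)"
      using L \<alpha> by (intro powr_mono) auto
    then have "real L \<le> real L powr (2 - \<alpha>)" using L by simp
    then show ?thesis by (intro add_mono mult_left_mono mult_right_mono order_refl) auto
  qed
  also have "\<dots> = (2 * real t * real s ^ 4 + 9) * real L powr (2 - \<alpha>)"
    by (simp add: E_def algebra_simps)
  finally show ?thesis by (simp only: p_def J_def L_def)
qed auto

text \<open>Expanding the square turns the sum over the Cantor set into the cosine products of pairs.\<close>

lemma weyl_square_average_le:
  fixes r s a b A B :: nat and \<alpha> :: real and t :: int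
  assumes r: "r \<ge> 2" and s: "s \<ge> 3" and t: "t \<noteq> 0" and a: "a \<ge> 1"
    and sc: "schmidt_const r s \<alpha>" and \<alpha>: "\<alpha> \<le> 1"
    and lo: "s ^ a \<le> r ^ (A + 1)" and hi: "r ^ B < s ^ (b + 1)"
  defines "K \<equiv> {a + 1..b - 2}"
  shows "(\<Sum>T\<in>Pow K. (cmod (\<Sum>j = A + 1..B. unit_exp (real r ^ j * of_int t * (\<eta> + (\<Sum>k\<in>T. 1 / real s ^ k)))))\<^sup>2)
    \<le> 2 ^ card K * ((2 * real_of_int \<bar>t\<bar> * real s ^ 4 + 9) * real (B - A) powr (2 - \<alpha>))"
proof -
  define x where "x T = \<eta> + (\<Sum>k\<in>T. 1 / real s ^ k)" for T
  define J where "J = {A + 1..B}"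
  define n where "n = nat \<bar>t\<bar>"
  have n: "n \<ge> 1" "real n = \<bar>of_int t\<bar>" using t by (auto simp: n_def)
  have D: "real r ^ i * of_int t * x T - real r ^ j * of_int t * x T =
      ((real r ^ i - real r ^ j) * of_int t) * x T" for i j T
    by (simp add: algebra_simps)
  have "(\<Sum>T\<in>Pow K. (cmod (\<Sum>j\<in>J. unit_exp (real r ^ j * of_int t * x T)))\<^sup>2) =
      cmod (of_real (\<Sum>T\<in>Pow K. (cmod (\<Sum>j\<in>J. unit_exp (real r ^ j * of_int t * x T)))\<^sup>2))"
    by (simp only: norm_of_real abs_of_nonneg sum_nonneg zero_le_power2)
  also have "\<dots> = cmod (\<Sum>T\<in>Pow K. \<Sum>i\<in>J. \<Sum>j\<in>J. unit_exp (((real r ^ i - real r ^ j) * of_int t) * x T))"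
    by (simp only: of_real_sum norm_sum_unit_exp_square D)
  also have "\<dots> = cmod (\<Sum>i\<in>J. \<Sum>j\<in>J. \<Sum>T\<in>Pow K. unit_exp (((real r ^ i - real r ^ j) * of_int t) * x T))"
    by (subst sum.swap, rule arg_cong[where f = cmod], intro sum.cong refl, rule sum.swap)
  also have "\<dots> \<le> (\<Sum>i\<in>J. \<Sum>j\<in>J. cmod (\<Sum>T\<in>Pow K. unit_exp (((real r ^ i - real r ^ j) * of_int t) * x T)))"
    by (intro order.trans[OF norm_sum] sum_mono norm_sum)
  also have "\<dots> = (\<Sum>i\<in>J. \<Sum>j\<in>J. 2 ^ card K *
      (\<Prod>k\<in>K. \<bar>cos (pi * ((real r ^ i - real r ^ j) * real n / real s ^ k))\<bar>))"
  proof (intro sum.cong refl)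
    fix i j
    have "\<bar>cos (pi * ((real r ^ i - real r ^ j) * of_int t * (1 / real s ^ k)))\<bar> =
        \<bar>cos (pi * ((real r ^ i - real r ^ j) * real n / real s ^ k))\<bar>" for k
      unfolding n by (cases "t > 0") (auto simp: abs_if cos_minus)
    then show "cmod (\<Sum>T\<in>Pow K. unit_exp (((real r ^ i - real r ^ j) * of_int t) * x T)) = 2 ^ card K *
      (\<Prod>k\<in>K. \<bar>cos (pi * ((real r ^ i - real r ^ j) * real n / real s ^ k))\<bar>)"
      unfolding x_def by (subst norm_sum_unit_exp_subset_sums) (simp_all add: K_def)
  qed
  also have "\<dots> = 2 ^ card K * (\<Sum>i\<in>J. \<Sum>j\<in>J.
      (\<Prod>k\<in>K. \<bar>cos (pi * ((real r ^ i - real r ^ j) * real n / real s ^ k))\<bar>))"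
    by (simp only: sum_distrib_left)
  also have "\<dots> \<le> 2 ^ card K * ((2 * real n * real s ^ 4 + 9) * real (B - A) powr (2 - \<alpha>))"
    unfolding J_def K_def
    by (intro mult_left_mono cos_product_pair_sum_le r s n a sc \<alpha> lo hi) auto
  finally show ?thesis by (simp add: x_def J_def n)
qed

section \<open>Weyl sums of the constructed number\<close>

lemma Least_minimizer:
  fixes f :: "real \<Rightarrow> 'b :: linorder"
  assumes "finite X" "X \<noteq> {}"
  shows "(LEAST x. x \<in> X \<and> (\<forall>y\<in>X. f x \<le> f y)) \<in> X"
    and "y \<in> X \<Longrightarrow> f (LEAST x. x \<in> X \<and> (\<forall>y\<in>X. f x \<le> f y)) \<le> f y"
proof -
  let ?P = "\<lambda>x. x \<in> X \<and> (\<forall>y\<in>X. f x \<le> f y)"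
  have "\<exists>x. ?P x"
    using arg_min_if_finite(1)[OF assms, of f] arg_min_least[OF assms(1,2), of _ f] by blast
  moreover have "finite {x. ?P x}" using assms by simp
  ultimately have "Min {x. ?P x} \<in> {x. ?P x}" "(LEAST x. ?P x) = Min {x. ?P x}"
    by (intro Min_in Least_Min; auto)+
  then have "?P (LEAST x. ?P x)" by auto
  then show "(LEAST x. ?P x) \<in> X" and "y \<in> X \<Longrightarrow> f (LEAST x. ?P x) \<le> f y" by auto
qed

lemma sum_inverse_powers_le:
  fixes s :: real
  assumes "s \<ge> 2"
  shows "(\<Sum>k = a + 1..n. 1 / s ^ k) \<le> 1 / s ^ a"
proof (cases "a \<le> n")
  case True
  then have "(\<Sum>k = a + 1..n. 1 / s ^ k) \<le> 1 / s ^ a - 1 / s ^ n"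
  proof (induction n rule: dec_induct)
    case (step n)
    have "2 * (1 / s ^ Suc n) \<le> s * (1 / s ^ Suc n)"
      using assms by (intro mult_right_mono) auto
    also have "\<dots> = 1 / s ^ n" using assms by simp
    finally show ?case using step by simp
  qed simp
  moreover have "1 / s ^ n \<ge> 0" using assms by simp
  ultimately show ?thesis by linarith
qed (use assms in auto)

text \<open>A choice of digits is the set of positions of the digit \<open>1\<close>, which makes the candidate set finite.\<close>

lemma sigma_eq:
  "sigma s m x = (\<lambda>T. eta s m x + (\<Sum>k\<in>T. 1 / real (s m) ^ k)) ` Pow {a_ind s m + 1..b_ind s m - 2}"
  (is "_ = ?f ` Pow ?K")
proof (intro subset_antisym subsetI)
  fix z assume "z \<in> sigma s m x"
  then obtain c :: "nat \<Rightarrow> real" where c: "\<forall>k\<in>?K. c k \<in> {0, 1}" "z = eta s m x + (\<Sum>k\<in>?K. c k / real (s m) ^ k)"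
    unfolding sigma_def by blast
  have "(\<Sum>k\<in>?K. c k / real (s m) ^ k) = (\<Sum>k\<in>?K. if c k = 1 then 1 / real (s m) ^ k else 0)"
    using c(1) by (intro sum.cong) auto
  also have "\<dots> = (\<Sum>k\<in>{k\<in>?K. c k = 1}. 1 / real (s m) ^ k)"
    by (rule sum.inter_filter [symmetric]) simp
  finally have "z = ?f {k\<in>?K. c k = 1}" using c(2) by simp
  then show "z \<in> ?f ` Pow ?K" by blast
next
  fix z assume "z \<in> ?f ` Pow ?K"
  then obtain T where T: "T \<subseteq> ?K" "z = ?f T" by blast
  have "(\<Sum>k\<in>T. 1 / real (s m) ^ k) = (\<Sum>k\<in>?K. of_bool (k \<in> T) / real (s m) ^ k)"
    using T(1) by (intro sum.mono_neutral_cong_left) auto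
  then show "z \<in> sigma s m x"
    unfolding sigma_def T(2) by (intro CollectI exI[of _ "\<lambda>k. of_bool (k \<in> T)"]) auto
qed

lemma eta_bounds:
  assumes "s m > 0"
  shows "x \<le> eta s m x" and "eta s m x \<le> x + 1 / real (s m) ^ a_ind s m"
proof -
  define q where "q = real (s m) ^ a_ind s m"
  have q: "q > 0" using assms by (simp add: q_def)
  have eta: "eta s m x = of_int \<lceil>x * q\<rceil> / q"
    unfolding eta_def q_def [symmetric]
  proof (rule Least_equality)
    show "(\<exists>g::int. of_int \<lceil>x * q\<rceil> / q = of_int g / q) \<and> x \<le> of_int \<lceil>x * q\<rceil> / q"
      using q by (auto simp: le_divide_eq)
  next
    fix y assume "(\<exists>g::int. y = of_int g / q) \<and> x \<le> y"
    then obtain g :: int where g: "y = of_int g / q" "x \<le> y" by blast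
    then have "\<lceil>x * q\<rceil> \<le> g" using q by (simp add: ceiling_le_iff le_divide_eq)
    then show "of_int \<lceil>x * q\<rceil> / q \<le> y" using g q by (simp add: divide_right_mono)
  qed
  show "x \<le> eta s m x" unfolding eta using q by (simp add: le_divide_eq)
  have "of_int \<lceil>x * q\<rceil> \<le> x * q + 1" by linarith
  then show "eta s m x \<le> x + 1 / real (s m) ^ a_ind s m"
    unfolding eta q_def [symmetric] using q by (simp add: divide_le_eq distrib_right)
qed

lemma ang_bounds:
  "real (ang s m) \<le> exp (sqrt (real m)) + 2 * real (s 1) * real m ^ 3"
  "exp (sqrt (real m)) + 2 * real (s 1) * real m ^ 3 < real (ang s m) + 1"
proof -
  have "exp (sqrt (real m)) + 2 * real (s 1) * real m ^ 3 \<ge> 0" by simp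
  then show "real (ang s m) \<le> exp (sqrt (real m)) + 2 * real (s 1) * real m ^ 3"
    "exp (sqrt (real m)) + 2 * real (s 1) * real m ^ 3 < real (ang s m) + 1"
    unfolding ang_def by linarith+
qed

lemma ang2_bounds:
  assumes "x > 1"
  shows "real (ang2 s m x) \<le> real (ang s m) / ln x" "real (ang s m) / ln x < real (ang2 s m x) + 1"
proof -
  have "real (ang s m) / ln x \<ge> 0" using assms by simp
  then show "real (ang2 s m x) \<le> real (ang s m) / ln x" "real (ang s m) / ln x < real (ang2 s m x) + 1"
    unfolding ang2_def by linarith+
qed

text \<open>The index \<open>\<langle>m;x\<rangle>\<close> is defined so that \<open>x\<^bsup>\<langle>m;x\<rangle>\<^esup>\<close> is comparable to \<open>exp \<langle>m\<rangle>\<close> for every base \<open>x\<close>; this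
  is what links the powers of different bases.\<close>

lemma power_ang2_bounds:
  assumes "x > 1"
  shows "x ^ ang2 s m x \<le> exp (real (ang s m))" "exp (real (ang s m)) < x ^ (ang2 s m x + 1)"
proof -
  have x: "x ^ n = exp (real n * ln x)" for n
    using assms by (simp add: exp_of_nat_mult)
  have "ln x > 0" using assms by simp
  then show "x ^ ang2 s m x \<le> exp (real (ang s m))" "exp (real (ang s m)) < x ^ (ang2 s m x + 1)"
    unfolding x using ang2_bounds[OF assms, of s m]
    by (simp_all only: exp_le_cancel_iff exp_less_cancel_iff) (auto simp: field_simps)
qed

lemma exp_sqrt_Suc_le: "exp (sqrt (real (Suc m))) \<le> exp 1 * exp (sqrt (real m))"
proof -
  have "sqrt (real (Suc m)) \<le> 1 + sqrt (real m)"
    by (rule real_le_lsqrt) (auto simp: power2_sum)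
  then show ?thesis by (simp flip: exp_add)
qed

text \<open>From \<open>u / 6 \<le> exp (u / 6)\<close> with \<open>u = \<surd>m\<close>, raised to the sixth power.\<close>

lemma cube_le_exp_sqrt: "real m ^ 3 \<le> 46656 * exp (sqrt (real m))"
proof -
  have "sqrt (real m) / 6 \<le> exp (sqrt (real m) / 6)"
    using exp_ge_add_one_self[of "sqrt (real m) / 6"] by linarith
  then have "(sqrt (real m) / 6) ^ 6 \<le> exp (sqrt (real m) / 6) ^ 6"
    by (intro power_mono) auto
  also have "\<dots> = exp (sqrt (real m))"
    by (simp flip: exp_of_nat_mult)
  finally have "sqrt (real m) ^ 6 \<le> 46656 * exp (sqrt (real m))"
    by (simp add: power_divide)
  moreover have "sqrt (real m) ^ 6 = real m ^ 3"
    using power_mult[of "sqrt (real m)" 2 3] by simp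
  ultimately show ?thesis by simp
qed

text \<open>The sequences are the modified ones. The number \<open>b0\<close> will be the first minimum \<open>\<beta>\<^sub>1\<close>, and the
  last assumption is the purpose of the modification: in step \<open>m\<close> Schmidt's inequality holds for all bases
  considered with an exponent that decreases only like \<open>m\<^sup>-\<^sup>1\<^sup>/\<^sup>4\<close>.\<close>

locale schmidt_construction =
  fixes r s m0 :: "nat \<Rightarrow> nat" and b0 :: real
  assumes s_ge: "\<And>m. m \<ge> 1 \<Longrightarrow> s m \<ge> 3"
    and s_le: "\<And>m. m \<ge> 1 \<Longrightarrow> s m \<le> m * s 1"
    and r_ge: "\<And>i. i \<ge> 1 \<Longrightarrow> r i \<ge> 2"
    and b0: "b0 > 0" "b0 \<le> 1"
    and schmidt_exponent: "\<And>i m. 1 \<le> i \<Longrightarrow> i \<le> m \<Longrightarrow> m0 (r i) \<le> m \<Longrightarrow>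
      schmidt_const (r i) (s m) (b0 / real m powr (1 / 4))"
begin

abbreviation "\<xi> \<equiv> schmidt_seq r s m0"

definition ang_const :: real where
  "ang_const = (1 + 93312 * real (s 1)) * exp 1"

text \<open>The bound for the Weyl sums of the block number \<open>m\<close>. Its second factor is, up to a constant and a
  power of \<open>m\<close>, the length of the block raised to the power \<open>1 - \<beta>\<^sub>m / 2\<close>, with \<open>\<beta>\<^sub>m = b0 / m\<^sup>1\<^sup>/\<^sup>4\<close>.\<close>

definition block_bound :: "nat \<Rightarrow> real" where
  "block_bound m = (10 * real (s 1) ^ 2 * ang_const + 128 * real (s 1)) *
     (real m ^ 4 * exp (sqrt (real m) - b0 / 2 * real m powr (1 / 4)))"

lemma s1: "s 1 \<ge> 3" "real (s 1) \<ge> 3"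
  using s_ge[of 1] by auto

text \<open>The cubic term makes \<open>\<langle>m\<rangle>\<close> grow by at least \<open>2\<close> from the start, where \<open>exp \<surd>m\<close> alone would not; this
  is enough for the geometric decay of the corrections.\<close>

lemma ang_step: "real (ang s m) + 2 \<le> real (ang s (Suc m))"
proof -
  have "2 * real (s 1) * (real m ^ 3 + 1) \<le> 2 * real (s 1) * real (Suc m) ^ 3"
    by (intro mult_left_mono) (auto simp: power3_eq_cube algebra_simps)
  then have "2 * real (s 1) * real m ^ 3 + 2 * real (s 1) \<le> 2 * real (s 1) * real (Suc m) ^ 3"
    by (simp only: distrib_left mult_1_right)
  moreover have "exp (sqrt (real m)) \<le> exp (sqrt (real (Suc m)))" by simp
  ultimately show ?thesis
    using ang_bounds(1)[of s m] ang_bounds(2)[of "Suc m" s] s1(2) by linarith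
qed

lemma ang_mono: "m \<le> n \<Longrightarrow> ang s m \<le> ang s n"
proof -
  have "ang s n \<le> ang s (Suc n)" for n using ang_step[of n] by linarith
  then show "m \<le> n \<Longrightarrow> ang s m \<le> ang s n" by (rule lift_Suc_mono_le[of "ang s"])
qed

lemma ang2_mono: "m \<le> n \<Longrightarrow> x > 1 \<Longrightarrow> ang2 s m x \<le> ang2 s n x"
  unfolding ang2_def using ang_mono by (intro nat_mono floor_mono divide_right_mono) auto

lemma ang_le: "real (ang s m) \<le> (1 + 93312 * real (s 1)) * exp (sqrt (real m))"
proof -
  have "2 * real (s 1) * real m ^ 3 \<le> 2 * real (s 1) * (46656 * exp (sqrt (real m)))"
    by (intro mult_left_mono cube_le_exp_sqrt) auto
  then show ?thesis using ang_bounds(1)[of s m] by (simp add: algebra_simps)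
qed

lemma ang_Suc_le: "real (ang s (Suc m)) \<le> ang_const * exp (sqrt (real m))"
proof -
  have "(1 + 93312 * real (s 1)) * exp (sqrt (real (Suc m))) \<le>
      (1 + 93312 * real (s 1)) * (exp 1 * exp (sqrt (real m)))"
    by (intro mult_left_mono exp_sqrt_Suc_le) auto
  also have "\<dots> = ang_const * exp (sqrt (real m))"
    by (simp only: ang_const_def mult_ac)
  finally show ?thesis using ang_le[of "Suc m"] by linarith
qed

lemma ang_const_ge: "ang_const \<ge> 1"
  unfolding ang_const_def using mult_mono[of 1 "1 + 93312 * real (s 1)" 1 "exp 1"] by auto

lemma a_ind_pos:
  assumes "m \<ge> 1"
  shows "a_ind s m \<ge> 1"
proof -
  have "real (s m) \<le> real (m * s 1)"
    using s_le[OF assms] by (rule of_nat_mono)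
  also have "\<dots> \<le> real m ^ 3 * real (s 1)"
    using power_increasing[of 1 3 "real m"] assms by (simp add: mult_right_mono)
  also have "\<dots> \<le> real (ang s m)"
  proof -
    have "1 \<le> real m ^ 3 * real (s 1)"
      using mult_mono[of 1 "real m ^ 3" 1 "real (s 1)"] s1 assms by auto
    moreover have "exp (sqrt (real m)) \<ge> 0" by simp
    moreover have "2 * real (s 1) * real m ^ 3 = 2 * (real m ^ 3 * real (s 1))" by simp
    ultimately show ?thesis using ang_bounds(2)[of m s] by linarith
  qed
  finally have "real (s m) \<le> real (ang s m)" .
  moreover have "ln (real (s m)) < real (s m)" "ln (real (s m)) > 0"
    using s_ge[OF assms] by (auto intro: ln_less_self)
  ultimately have "1 \<le> real (ang s m) / ln (real (s m))" by simp
  moreover have "real (s m) > 1" using s_ge[OF assms] by simp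
  ultimately have "real (ang2 s m (real (s m))) + 1 > 1"
    using ang2_bounds(2)[of "real (s m)" s m] by linarith
  then show ?thesis unfolding a_ind_def by simp
qed

lemma finite_sigma: "finite (sigma s m x)" and sigma_nonempty: "sigma s m x \<noteq> {}"
  unfolding sigma_eq by auto

lemma seq_in_sigma: "\<xi> (Suc m) \<in> sigma s (Suc m) (\<xi> m)"
  using Least_minimizer(1)[OF finite_sigma sigma_nonempty] by simp

lemma seq_minimizes: "y \<in> sigma s (Suc m) (\<xi> m) \<Longrightarrow> A' r s m0 (Suc m) (\<xi> (Suc m)) \<le> A' r s m0 (Suc m) y"
  using Least_minimizer(2)[OF finite_sigma sigma_nonempty] by simp

definition step_bound :: "nat \<Rightarrow> real" where
  "step_bound m = 2 * real (s 1) * real m * exp (- real (ang s m))"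

lemma step_bound_halves:
  assumes "m \<ge> 1"
  shows "2 * step_bound (Suc m) \<le> step_bound m"
proof -
  have e: "exp (- 2) \<le> (1 / 4 :: real)"
  proof -
    have "(2::real) * 2 \<le> exp 1 * exp 1" using exp_ge_add_one_self[of 1] by (intro mult_mono) auto
    then show ?thesis by (simp add: exp_minus field_simps flip: exp_add)
  qed
  have "exp (- real (ang s (Suc m))) \<le> exp (- real (ang s m) + - 2)"
    using ang_step[of m] by simp
  also have "\<dots> \<le> exp (- real (ang s m)) * (1 / 4)"
    unfolding exp_add using e by (intro mult_left_mono) auto
  finally have "real (Suc m) * exp (- real (ang s (Suc m))) \<le> (2 * real m) * (exp (- real (ang s m)) * (1 / 4))"
    using assms by (intro mult_mono) auto
  then have "(4 * real (s 1)) * (real (Suc m) * exp (- real (ang s (Suc m)))) \<le>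
      (4 * real (s 1)) * ((2 * real m) * (exp (- real (ang s m)) * (1 / 4)))"
    by (intro mult_left_mono) auto
  then show ?thesis by (simp add: step_bound_def mult_ac)
qed

lemma step_bound_nonneg: "step_bound m \<ge> 0"
  by (simp add: step_bound_def)

lemma seq_step: "\<xi> m \<le> \<xi> (Suc m)" "\<xi> (Suc m) \<le> \<xi> m + step_bound (Suc m)"
proof -
  define n where "n = Suc m"
  define q where "q = real (s n)"
  have s: "s n \<ge> 3" using s_ge[of n] by (simp add: n_def)
  have q: "q \<ge> 3" using s by (simp add: q_def)
  obtain T where T: "T \<subseteq> {a_ind s n + 1..b_ind s n - 2}" "\<xi> n = eta s n (\<xi> m) + (\<Sum>k\<in>T. 1 / q ^ k)"
    using seq_in_sigma[of m] unfolding sigma_eq n_def q_def by blast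
  have "(\<Sum>k\<in>T. 1 / q ^ k) \<ge> 0" using q by (intro sum_nonneg) auto
  then show "\<xi> m \<le> \<xi> (Suc m)" using T(2) eta_bounds(1)[of s n "\<xi> m"] s by (simp add: n_def)
  have "(\<Sum>k\<in>T. 1 / q ^ k) \<le> (\<Sum>k = a_ind s n + 1..b_ind s n - 2. 1 / q ^ k)"
    using T(1) q by (intro sum_mono2) auto
  also have "\<dots> \<le> 1 / q ^ a_ind s n" using q by (intro sum_inverse_powers_le) auto
  finally have "\<xi> n \<le> \<xi> m + 2 * (1 / q ^ a_ind s n)"
    using T(2) eta_bounds(2)[of s n "\<xi> m"] s by (simp add: q_def)
  also have "1 / q ^ a_ind s n \<le> q * exp (- real (ang s n))"
  proof -
    have "exp (real (ang s n)) \<le> q * q ^ a_ind s n"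
      using power_ang2_bounds(2)[of q s n] q by (simp add: a_ind_def q_def)
    then show ?thesis using q by (simp add: exp_minus field_simps)
  qed
  also have "q * exp (- real (ang s n)) \<le> (real n * real (s 1)) * exp (- real (ang s n))"
  proof (intro mult_right_mono)
    have "s n \<le> n * s 1" using s_le[of n] by (simp add: n_def)
    then show "q \<le> real n * real (s 1)" unfolding q_def by (metis of_nat_le_iff of_nat_mult)
  qed auto
  finally show "\<xi> (Suc m) \<le> \<xi> m + step_bound (Suc m)"
    by (simp add: n_def step_bound_def mult_ac)
qed

text \<open>The bounds for the steps at least halve each time, so all later steps together are at most twice the
  next one.\<close>

lemma schmidt_number_bounds:
  "\<xi> m \<le> schmidt_number r s m0" "schmidt_number r s m0 \<le> \<xi> m + 2 * step_bound (Suc m)"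
proof -
  have inc: "incseq \<xi>" by (intro incseq_SucI seq_step)
  have up: "\<xi> n \<le> \<xi> m + 2 * step_bound (Suc m) - 2 * step_bound (Suc n)" if "m \<le> n" for m n
    using that
  proof (induction n rule: dec_induct)
    case (step n)
    then show ?case using seq_step(2)[of n] step_bound_halves[of "Suc n"] by simp
  qed simp
  have up': "\<xi> n \<le> \<xi> m + 2 * step_bound (Suc m)" for m n
    using up[of m n] incseqD[OF inc, of n m] step_bound_nonneg[of "Suc n"] step_bound_nonneg[of "Suc m"]
    by (cases "m \<le> n") auto
  have "convergent \<xi>"
  proof (rule incseq_convergent[OF inc])
    show "\<forall>n. \<xi> n \<le> \<xi> 0 + 2 * step_bound (Suc 0)" using up'[of _ 0] by blast
  qed (auto simp: convergent_def)
  then have lim: "\<xi> \<longlonglongrightarrow> schmidt_number r s m0"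
    by (simp add: schmidt_number_def convergent_LIMSEQ_iff)
  show "\<xi> m \<le> schmidt_number r s m0" by (rule incseq_le[OF inc lim])
  show "schmidt_number r s m0 \<le> \<xi> m + 2 * step_bound (Suc m)"
    by (rule LIMSEQ_le_const2[OF lim]) (use up' in blast)
qed

text \<open>The minimum over the candidates is at most the mean, and the mean is the sum of the mean squares over
  at most \<open>2 m \<cdot> m\<close> pairs of a frequency and a base.\<close>

lemma A'_seq_le:
  assumes m: "m \<ge> 1"
  shows "A' r s m0 m (\<xi> m) \<le>
     (10 * real (s 1) ^ 2 * ang_const * (real m ^ 4 * exp (sqrt (real m) - b0 / 2 * real m powr (1 / 4))))\<^sup>2"
proof -
  obtain m' where m': "m = Suc m'" using m by (cases m) auto
  define K where "K = {a_ind s m + 1..b_ind s m - 2}"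
  define \<eta> where "\<eta> = eta s m (\<xi> m')"
  define x where "x T = \<eta> + (\<Sum>k\<in>T. 1 / real (s m) ^ k)" for T
  define \<alpha> where "\<alpha> = b0 / real m powr (1 / 4)"
  define I where "I = {i\<in>{1..m}. m0 (r i) \<le> m}"
  define H where "H = {- int m..int m} - {0}"
  define V where "V = 2 * ang_const * exp (sqrt (real m))"
  define B where "B = (2 * real m * real (s m) ^ 4 + 9) * V powr (2 - \<alpha>)"
  have K: "finite K" by (simp add: K_def)
  have \<alpha>: "0 < \<alpha>" "\<alpha> \<le> 1"
    using b0 m ge_one_powr_ge_zero[of "real m" "1 / 4"] by (auto simp: \<alpha>_def divide_le_eq)
  have V1: "V \<ge> 1" 
    using mult_mono[of 1 ang_const 1 "exp (sqrt (real m))"] ang_const_ge by (auto simp: V_def)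
  have each: "(\<Sum>T\<in>Pow K. (cmod (\<Sum>j = ang2 s m (real (r i)) + 1..ang2 s (m + 1) (real (r i)).
           unit_exp (real (r i) ^ j * of_int t * x T)))\<^sup>2) \<le> 2 ^ card K * B"
    if t: "t \<in> H" and i: "i \<in> I" for t i
  proof -
    define q where "q = real (r i)"
    have r: "r i \<ge> 2" using r_ge i by (auto simp: I_def)
    then have q: "q \<ge> 2" by (simp add: q_def)
    have s: "s m \<ge> 3" using s_ge m by simp
    have "(\<Sum>T\<in>Pow K. (cmod (\<Sum>j = ang2 s m (real (r i)) + 1..ang2 s (m + 1) (real (r i)).
           unit_exp (real (r i) ^ j * of_int t * x T)))\<^sup>2) \<le>
        2 ^ card K * ((2 * real_of_int \<bar>t\<bar> * real (s m) ^ 4 + 9) *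
          real (ang2 s (m + 1) q - ang2 s m q) powr (2 - \<alpha>))"
      unfolding K_def x_def q_def
    proof (intro weyl_square_average_le r s a_ind_pos m \<alpha>)
      show "t \<noteq> 0" using t by (simp add: H_def)
      show "schmidt_const (r i) (s m) \<alpha>"
        using schmidt_exponent i by (auto simp: I_def \<alpha>_def)
      have "real (s m) ^ a_ind s m \<le> exp (real (ang s m))"
        using power_ang2_bounds(1)[of "real (s m)" s m] s by (simp add: a_ind_def)
      also have "\<dots> \<le> real (r i) ^ (ang2 s m (real (r i)) + 1)"
        using power_ang2_bounds(2)[of "real (r i)" s m] r by simp
      finally show "s m ^ a_ind s m \<le> r i ^ (ang2 s m (real (r i)) + 1)"
        by (simp only: of_nat_power [symmetric] of_nat_le_iff)
      have "real (r i) ^ ang2 s (m + 1) (real (r i)) \<le> exp (real (ang s (m + 1)))"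
        using power_ang2_bounds(1)[of "real (r i)" s "m + 1"] r by simp
      also have "\<dots> < real (s m) ^ (b_ind s m + 1)"
        using power_ang2_bounds(2)[of "real (s m)" s "m + 1"] s by (simp add: b_ind_def)
      finally show "r i ^ ang2 s (m + 1) (real (r i)) < s m ^ (b_ind s m + 1)"
        by (simp only: of_nat_power [symmetric] of_nat_less_iff)
    qed
    also have "\<dots> \<le> 2 ^ card K * ((2 * real m * real (s m) ^ 4 + 9) * V powr (2 - \<alpha>))"
    proof (intro mult_left_mono mult_mono add_mono mult_right_mono powr_mono2)
      show "real_of_int \<bar>t\<bar> \<le> real m" using t by (auto simp: H_def)
      have "1 / 2 \<le> ln q"
      proof -
        have "1 / 2 \<le> ln (2 :: real)" using ln2_ge_two_thirds by simp
        also have "\<dots> \<le> ln q" using q by simp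
        finally show ?thesis .
      qed
      have "real (ang2 s (m + 1) q - ang2 s m q) \<le> real (ang2 s (m + 1) q)" by simp
      also have "\<dots> \<le> real (ang s (m + 1)) / ln q"
        using q by (intro ang2_bounds) auto
      also have "\<dots> \<le> real (ang s (m + 1)) / (1 / 2)"
        using \<open>1 / 2 \<le> ln q\<close> by (intro divide_left_mono) auto
      also have "\<dots> \<le> V"
        using ang_Suc_le[of m] by (simp add: V_def)
      finally show "real (ang2 s (m + 1) q - ang2 s m q) \<le> V" .
    qed (use \<alpha> V1 in auto)
    finally show ?thesis unfolding B_def .
  qed
  have B0: "B \<ge> 0" by (simp add: B_def)
  have "2 ^ card K * A' r s m0 m (\<xi> m) = (\<Sum>T\<in>Pow K. A' r s m0 m (\<xi> m))"
    by (simp add: card_Pow K)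
  also have "\<dots> \<le> (\<Sum>T\<in>Pow K. A' r s m0 m (x T))"
  proof (intro sum_mono)
    fix T assume "T \<in> Pow K"
    then have "x T \<in> sigma s (Suc m') (\<xi> m')"
      unfolding sigma_eq x_def \<eta>_def K_def m' by blast
    then show "A' r s m0 m (\<xi> m) \<le> A' r s m0 m (x T)"
      unfolding m' by (rule seq_minimizes)
  qed
  also have "\<dots> = (\<Sum>t\<in>H. \<Sum>i\<in>I. \<Sum>T\<in>Pow K.
      (cmod (\<Sum>j = ang2 s m (real (r i)) + 1..ang2 s (m + 1) (real (r i)).
           unit_exp (real (r i) ^ j * of_int t * x T)))\<^sup>2)"
    unfolding A'_def H_def [symmetric] I_def [symmetric]
    by (subst sum.swap, intro sum.cong refl, rule sum.swap)
  also have "\<dots> \<le> (\<Sum>t\<in>H. \<Sum>i\<in>I. 2 ^ card K * B)"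
    by (intro sum_mono each)
  also have "\<dots> = 2 ^ card K * (real (card H * card I) * B)"
    by simp
  finally have "A' r s m0 m (\<xi> m) \<le> real (card H * card I) * B" by simp
  also have "\<dots> \<le> real (2 * m * m) * B"
  proof -
    have "card I \<le> card {1..m}" by (intro card_mono) (auto simp: I_def)
    moreover have "card H = 2 * m" by (simp add: H_def)
    ultimately have "card H * card I \<le> 2 * m * m" by simp
    then show ?thesis using B0 by (intro mult_right_mono of_nat_mono)
  qed
  also have "\<dots> \<le> real (2 * m * m) * ((2 * real m * (real m * real (s 1)) ^ 4 + 9) * (4 * ang_const ^ 2 *
      exp (2 * sqrt (real m) - b0 * real m powr (1 / 4))))"
    unfolding B_def
  proof (intro mult_left_mono mult_mono add_mono power_mono)
    have "real (s m) \<le> real (m * s 1)" using s_le[OF m] by (rule of_nat_mono)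
    then show "real (s m) \<le> real m * real (s 1)" by simp
    have "V powr (2 - \<alpha>) = (2 * ang_const) powr (2 - \<alpha>) * exp (sqrt (real m)) powr (2 - \<alpha>)"
      unfolding V_def by (rule powr_mult)
    also have "\<dots> \<le> (2 * ang_const) powr 2 * exp (2 * sqrt (real m) - b0 * real m powr (1 / 4))"
    proof (intro mult_mono powr_mono)
      \<comment> \<open>Here \<open>\<beta>\<^sub>m \<surd>m\<close> becomes \<open>b0 m\<^sup>1\<^sup>/\<^sup>4\<close>, the saving in the exponent.\<close>
      have "sqrt (real m) = real m powr (1 / 4) * real m powr (1 / 4)"
        using m by (simp add: powr_half_sqrt flip: powr_add)
      then have "\<alpha> * sqrt (real m) = b0 * real m powr (1 / 4)"
        using m by (simp add: \<alpha>_def)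
      then show "exp (sqrt (real m)) powr (2 - \<alpha>) \<le> exp (2 * sqrt (real m) - b0 * real m powr (1 / 4))"
        by (simp add: powr_def algebra_simps)
    qed (use \<alpha> ang_const_ge in auto)
    also have "(2 * ang_const) powr 2 = 4 * ang_const ^ 2"
      using ang_const_ge by (simp add: power_mult_distrib)
    finally show "V powr (2 - \<alpha>) \<le> 4 * ang_const ^ 2 * exp (2 * sqrt (real m) - b0 * real m powr (1 / 4))" .
  qed auto
  also have "\<dots> \<le> (25 * real (s 1) ^ 4 * real m ^ 8) * (4 * ang_const ^ 2 *
      exp (2 * sqrt (real m) - b0 * real m powr (1 / 4)))"
  proof -
    have m1: "real m \<ge> 1" using m by simp
    have "81 \<le> real (s 1) ^ 4" using power_mono[OF s1(2), of 4] by simp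
    then have s4: "18 \<le> real (s 1) ^ 4" by linarith
    have "real (2 * m * m) * (2 * real m * (real m * real (s 1)) ^ 4 + 9) =
        4 * (real (s 1) ^ 4 * real m ^ 7) + 18 * real m ^ 2"
      by (simp add: power_mult_distrib eval_nat_numeral algebra_simps)
    also have "\<dots> \<le> 4 * (real (s 1) ^ 4 * real m ^ 8) + real (s 1) ^ 4 * real m ^ 8"
      using m1 s4 by (intro add_mono mult_left_mono mult_mono power_increasing) auto
    also have "\<dots> \<le> 25 * real (s 1) ^ 4 * real m ^ 8" by simp
    finally show ?thesis
      unfolding mult.assoc [of "real (2 * m * m)", symmetric] by (intro mult_right_mono) auto
  qed
  also have "\<dots> = (10 * real (s 1) ^ 2 * ang_const * (real m ^ 4 * exp (sqrt (real m) - b0 / 2 * real m powr (1 / 4))))\<^sup>2"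
  proof -
    have "exp (2 * sqrt (real m) - b0 * real m powr (1 / 4)) = (exp (sqrt (real m) - b0 / 2 * real m powr (1 / 4)))\<^sup>2"
      by (simp add: power2_eq_square flip: exp_add)
    then show ?thesis by (simp add: power_mult_distrib flip: power_mult)
  qed
  finally show ?thesis .
qed

text \<open>A single Weyl sum at \<open>\<xi>\<^sub>m\<close> is one of the terms that were minimized together. Replacing \<open>\<xi>\<^sub>m\<close> by the limit
  changes it by at most a constant times \<open>m \<bar>\<xi> - \<xi>\<^sub>m\<bar> r\<^sup>j\<close> summed over \<open>j\<close>; the largest power \<open>r\<^sup>j\<close> is at
  most \<open>exp \<langle>m+1\<rangle>\<close>, which the factor \<open>exp (- \<langle>m+1\<rangle>)\<close> in \<open>\<bar>\<xi> - \<xi>\<^sub>m\<bar>\<close> cancels.\<close>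

lemma weyl_block_le:
  assumes i: "1 \<le> i" "i \<le> m" "m0 (r i) \<le> m" and t: "t \<noteq> 0" "\<bar>t\<bar> \<le> int m"
  shows "cmod (\<Sum>j = ang2 s m (real (r i)) + 1..ang2 s (Suc m) (real (r i)).
           unit_exp (real (r i) ^ j * of_int t * schmidt_number r s m0)) \<le> block_bound m"
proof -
  define J where "J = {ang2 s m (real (r i)) + 1..ang2 s (Suc m) (real (r i))}"
  define n where "n = ang2 s (Suc m) (real (r i))"
  define x where "x = schmidt_number r s m0"
  define y where "y = \<xi> m"
  define e where "e = real m ^ 4 * exp (sqrt (real m) - b0 / 2 * real m powr (1 / 4))"
  have m: "m \<ge> 1" using i by simp
  have r: "real (r i) \<ge> 2" using r_ge[OF i(1)] by simp
  define g where "g i' = (cmod (\<Sum>j = ang2 s m (real (r i')) + 1..ang2 s (m + 1) (real (r i')).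
           unit_exp (real (r i') ^ j * of_int t * y)))\<^sup>2" for i'
  have "(cmod (\<Sum>j\<in>J. unit_exp (real (r i) ^ j * of_int t * y)))\<^sup>2 = g i"
    by (simp add: J_def g_def)
  also have "\<dots> \<le> (\<Sum>i'\<in>{i\<in>{1..m}. m0 (r i) \<le> m}. g i')"
    using i by (intro member_le_sum) (auto simp: g_def)
  also have "\<dots> \<le> A' r s m0 m y"
    unfolding A'_def g_def using t by (intro member_le_sum[of t]) (auto intro: sum_nonneg)
  also have "\<dots> \<le> (10 * real (s 1) ^ 2 * ang_const * e)\<^sup>2"
    unfolding y_def e_def by (rule A'_seq_le[OF m])
  finally have at_y: "cmod (\<Sum>j\<in>J. unit_exp (real (r i) ^ j * of_int t * y)) \<le> 10 * real (s 1) ^ 2 * ang_const * e"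
    using ang_const_ge by (elim power2_le_imp_le) (auto simp: e_def)
  have xy: "\<bar>x - y\<bar> \<le> 2 * step_bound (Suc m)"
    using schmidt_number_bounds[of m] by (simp add: x_def y_def)
  have geo: "(\<Sum>j\<in>J. real (r i) ^ j) \<le> 2 * exp (real (ang s (Suc m)))"
  proof -
    have "(\<Sum>j\<in>J. real (r i) ^ j) \<le> (\<Sum>j\<le>n. real (r i) ^ j)"
      using r by (intro sum_mono2) (auto simp: J_def n_def)
    also have "\<dots> \<le> 2 * real (r i) ^ n"
    proof (induction n)
      case (Suc n)
      have "2 * real (r i) ^ n \<le> real (r i) * real (r i) ^ n" using r by (intro mult_right_mono) auto
      then show ?case using Suc by simp
    qed simp
    also have "real (r i) ^ n \<le> exp (real (ang s (Suc m)))"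
      unfolding n_def using r by (intro power_ang2_bounds) auto
    finally show ?thesis by simp
  qed
  have "cmod ((\<Sum>j\<in>J. unit_exp (real (r i) ^ j * of_int t * x)) - (\<Sum>j\<in>J. unit_exp (real (r i) ^ j * of_int t * y))) \<le>
      (\<Sum>j\<in>J. cmod (unit_exp (real (r i) ^ j * of_int t * x) - unit_exp (real (r i) ^ j * of_int t * y)))"
    unfolding sum_subtractf [symmetric] by (rule norm_sum)
  also have "\<dots> \<le> (\<Sum>j\<in>J. real (r i) ^ j * (8 * (real m * (2 * step_bound (Suc m)))))"
  proof (intro sum_mono)
    fix j
    have "cmod (unit_exp (real (r i) ^ j * of_int t * x) - unit_exp (real (r i) ^ j * of_int t * y)) \<le>
        2 * pi * \<bar>real (r i) ^ j * of_int t * x - real (r i) ^ j * of_int t * y\<bar>"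
      by (rule norm_unit_exp_diff_le)
    also have "\<dots> = (2 * pi) * (real (r i) ^ j * (\<bar>of_int t\<bar> * \<bar>x - y\<bar>))"
      by (simp add: abs_mult mult.assoc flip: right_diff_distrib)
    also have "\<dots> \<le> 8 * (real (r i) ^ j * (real m * (2 * step_bound (Suc m))))"
      using t xy pi_less_4 step_bound_nonneg by (intro mult_mono) auto
    finally show "cmod (unit_exp (real (r i) ^ j * of_int t * x) - unit_exp (real (r i) ^ j * of_int t * y)) \<le>
        real (r i) ^ j * (8 * (real m * (2 * step_bound (Suc m))))" by (simp add: mult_ac)
  qed
  also have "\<dots> = (\<Sum>j\<in>J. real (r i) ^ j) * (8 * (real m * (2 * step_bound (Suc m))))"
    by (simp only: sum_distrib_right)
  also have "\<dots> \<le> (2 * exp (real (ang s (Suc m)))) * (8 * (real m * (2 * step_bound (Suc m))))"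
    using step_bound_nonneg by (intro mult_right_mono geo) auto
  also have "\<dots> = 64 * real (s 1) * (real m * real (Suc m))"
    by (simp add: step_bound_def exp_minus)
  also have "\<dots> \<le> 64 * real (s 1) * (2 * e)"
  proof (intro mult_left_mono)
    have m1: "real m \<ge> 1" using m by simp
    have "b0 / 2 * real m powr (1 / 4) \<le> 1 * real m powr (1 / 2)"
      using m b0 by (intro mult_mono powr_mono) auto
    then have "1 \<le> exp (sqrt (real m) - b0 / 2 * real m powr (1 / 4))"
      using m by (simp add: powr_half_sqrt)
    then have "real m ^ 4 * 1 \<le> e" unfolding e_def by (intro mult_left_mono) auto
    moreover have "real m * real (Suc m) \<le> 2 * real m ^ 2"
      using m1 by (simp add: power2_eq_square distrib_left)
    moreover have "real m ^ 2 \<le> real m ^ 4" using m1 by (intro power_increasing) auto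
    ultimately show "real m * real (Suc m) \<le> 2 * e" by linarith
  qed auto
  finally have "cmod (\<Sum>j\<in>J. unit_exp (real (r i) ^ j * of_int t * x)) \<le>
      10 * real (s 1) ^ 2 * ang_const * e + 64 * real (s 1) * (2 * e)"
    using at_y norm_triangle_ineq2[of "\<Sum>j\<in>J. unit_exp (real (r i) ^ j * of_int t * x)"
        "\<Sum>j\<in>J. unit_exp (real (r i) ^ j * of_int t * y)"] by linarith
  then show ?thesis
    by (simp add: block_bound_def J_def x_def e_def algebra_simps)
qed

end

section \<open>From Weyl sums to the discrepancy\<close>

lemma eventually_sequentially_of_real:
  assumes "eventually P (at_top :: real filter)"
  shows "eventually (\<lambda>m. P (real m)) sequentially"
  using filterlim_real_sequentially assms by (simp add: filterlim_iff)

lemma eventually_weyl_negligible: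
  fixes b c d :: real
  assumes "b > 0"
  shows "eventually (\<lambda>m. real m * (c * exp (sqrt (real m) / 2) + real m * (d * (real m ^ 4 * exp (sqrt (real m) - b * real m powr (1 / 4)))))
    \<le> exp (sqrt (real m)) / sqrt (real m)) sequentially"
proof -
  have 1: "((\<lambda>x::real. x * (c * exp (sqrt x / 2)) * sqrt x / exp (sqrt x)) \<longlongrightarrow> 0) at_top"
    by real_asymp
  have 2: "((\<lambda>x::real. x * (x * (d * (x ^ 4 * exp (sqrt x - b * x powr (1 / 4))))) * sqrt x / exp (sqrt x)) \<longlongrightarrow> 0) at_top"
    using assms by real_asymp
  have "eventually (\<lambda>x::real. x * (c * exp (sqrt x / 2)) * sqrt x / exp (sqrt x) < 1 / 2) at_top"
    using order_tendstoD(2)[OF 1, of "1 / 2"] by simp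
  moreover have "eventually (\<lambda>x::real. x * (x * (d * (x ^ 4 * exp (sqrt x - b * x powr (1 / 4))))) * sqrt x / exp (sqrt x) < 1 / 2) at_top"
    using order_tendstoD(2)[OF 2, of "1 / 2"] by simp
  ultimately have "eventually (\<lambda>x::real. x * (c * exp (sqrt x / 2) + x * (d * (x ^ 4 * exp (sqrt x - b * x powr (1 / 4)))))
      \<le> exp (sqrt x) / sqrt x) at_top"
    using eventually_gt_at_top[of "0::real"]
  proof eventually_elim
    case (elim x)
    have "x * (c * exp (sqrt x / 2)) * sqrt x / exp (sqrt x) +
        x * (x * (d * (x ^ 4 * exp (sqrt x - b * x powr (1 / 4))))) * sqrt x / exp (sqrt x) \<le> 1"
      using elim by linarith
    then have "(x * (c * exp (sqrt x / 2) + x * (d * (x ^ 4 * exp (sqrt x - b * x powr (1 / 4)))))) * sqrt x / exp (sqrt x) \<le> 1"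
      by (simp only: distrib_left distrib_right add_divide_distrib)
    then show ?case using elim by (simp add: pos_divide_le_eq pos_le_divide_eq)
  qed
  then show ?thesis by (rule eventually_sequentially_of_real)
qed

text \<open>The derivative of \<open>exp \<surd>x\<close> is \<open>exp \<surd>x / (2 \<surd>x)\<close>, so one block is shorter than everything before it by
  a factor of the order of \<open>\<surd>x\<close>, the logarithm. Cutting off inside a block is
  one of the errors of order \<open>1 / \<surd>M\<close>.\<close>

lemma eventually_block_length_le:
  fixes c :: real
  assumes "c > 0"
  shows "eventually (\<lambda>m. (exp (sqrt (real m + 1)) + c * (real m + 1) ^ 3) - (exp (sqrt (real m)) + c * real m ^ 3) + 2
    \<le> exp (sqrt (real m)) / sqrt (real m)) sequentially"
proof -
  have 1: "((\<lambda>x::real. ((exp (sqrt (x + 1)) + c * (x + 1) ^ 3) - (exp (sqrt x) + c * x ^ 3) + 2) * sqrt x / exp (sqrt x)) \<longlongrightarrow> 1 / 2) at_top"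
    using assms by real_asymp
  have "eventually (\<lambda>x::real. ((exp (sqrt (x + 1)) + c * (x + 1) ^ 3) - (exp (sqrt x) + c * x ^ 3) + 2) * sqrt x / exp (sqrt x) < 1) at_top"
    using order_tendstoD(2)[OF 1, of 1] by simp
  then have "eventually (\<lambda>x::real. (exp (sqrt (x + 1)) + c * (x + 1) ^ 3) - (exp (sqrt x) + c * x ^ 3) + 2
    \<le> exp (sqrt x) / sqrt x) at_top"
    using eventually_gt_at_top[of "0::real"]
    by eventually_elim (simp add: pos_divide_less_eq pos_le_divide_eq)
  then show ?thesis by (rule eventually_sequentially_of_real)
qed

context schmidt_construction
begin

lemma block_bound_nonneg: "block_bound m \<ge> 0"
  using ang_const_ge by (simp add: block_bound_def)

lemma block_bound_mono:
  assumes "1 \<le> m" "m \<le> n"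
  shows "block_bound m \<le> block_bound n"
  unfolding block_bound_def
proof (intro mult_left_mono mult_mono)
  \<comment> \<open>With \<open>u = m\<^sup>1\<^sup>/\<^sup>4\<close> the exponent is \<open>u\<^sup>2 - b0 u / 2\<close>, which increases for \<open>u \<ge> 1\<close>.\<close>
  define u v where "u = real m powr (1 / 4)" and "v = real n powr (1 / 4)"
  have uv: "1 \<le> u" "u \<le> v"
    using assms by (auto simp: u_def v_def ge_one_powr_ge_zero powr_mono2)
  have "sqrt (real m) = u * u" "sqrt (real n) = v * v"
    using assms by (simp_all add: u_def v_def powr_half_sqrt flip: powr_add)
  moreover have "0 \<le> (v - u) * (v + u - b0 / 2)"
    using uv b0 by (intro mult_nonneg_nonneg) auto
  ultimately show "exp (sqrt (real m) - b0 / 2 * real m powr (1 / 4)) \<le> exp (sqrt (real n) - b0 / 2 * real n powr (1 / 4))"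
    unfolding u_def [symmetric] v_def [symmetric] by (simp add: algebra_simps diff_divide_distrib)
qed (use assms ang_const_ge in auto)

lemma ang2_le: "x \<ge> 2 \<Longrightarrow> real (ang2 s m x) \<le> 2 * real (ang s m)"
proof -
  assume x: "x \<ge> 2"
  have "1 / 2 \<le> ln (2 :: real)" using ln2_ge_two_thirds by simp
  also have "\<dots> \<le> ln x" using x by simp
  finally have "real (ang s m) / ln x \<le> real (ang s m) / (1 / 2)"
    by (intro divide_left_mono) auto
  then show ?thesis using ang2_bounds(1)[of x s m] x by simp
qed

text \<open>Blocks with number below \<open>M / 4\<close> are estimated trivially: together they have at most a constant times
  \<open>exp (\<surd>M / 2)\<close> terms, about the square root of the total. In the other blocks the frequency \<open>h\<close> and the base are under
  control.\<close>

lemma weyl_sum_le: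
  assumes i: "i \<ge> 1" and M: "4 * max i (m0 (r i)) \<le> M" and h: "h \<noteq> 0" "4 * \<bar>h\<bar> \<le> int M"
  shows "cmod (\<Sum>j = 1..ang2 s M (real (r i)). unit_exp (real (r i) ^ j * of_int h * schmidt_number r s m0))
    \<le> 2 * ang_const * exp (sqrt (real M) / 2) + real M * block_bound M"
proof -
  define v where "v = M div 4"
  define z where "z j = unit_exp (real (r i) ^ j * of_int h * schmidt_number r s m0)" for j
  have v: "i \<le> v" "m0 (r i) \<le> v" "\<bar>h\<bar> \<le> int v" "v \<le> M" using M h by (auto simp: v_def)
  have r: "real (r i) \<ge> 2" using r_ge[OF i] by simp
  have "cmod (\<Sum>j = 1..ang2 s n (real (r i)). z j) \<le> real (ang2 s v (real (r i))) + (\<Sum>m = v..<n. block_bound m)"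
    if "v \<le> n" for n
    using that
  proof (induction n rule: dec_induct)
    case base
    show ?case using norm_sum[of z "{1..ang2 s v (real (r i))}"] by (simp add: z_def)
  next
    case (step n)
    have "(\<Sum>j = 1..ang2 s (Suc n) (real (r i)). z j) =
        (\<Sum>j = 1..ang2 s n (real (r i)). z j) + (\<Sum>j = ang2 s n (real (r i)) + 1..ang2 s (Suc n) (real (r i)). z j)"
      using ang2_mono[of n "Suc n" "real (r i)"] r
      by (subst sum.union_disjoint [symmetric]) (auto intro!: sum.cong)
    moreover have "cmod (\<Sum>j = ang2 s n (real (r i)) + 1..ang2 s (Suc n) (real (r i)). z j) \<le> block_bound n"
      unfolding z_def using step v i h by (intro weyl_block_le) auto
    ultimately show ?case
      using step norm_triangle_ineq[of "\<Sum>j = 1..ang2 s n (real (r i)). z j"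
          "\<Sum>j = ang2 s n (real (r i)) + 1..ang2 s (Suc n) (real (r i)). z j"]
      by simp
  qed
  from this[OF v(4)] have "cmod (\<Sum>j = 1..ang2 s M (real (r i)). z j) \<le>
      real (ang2 s v (real (r i))) + (\<Sum>m = v..<M. block_bound m)" .
  also have "(\<Sum>m = v..<M. block_bound m) \<le> real (card {v..<M}) * block_bound M"
    using v i by (intro sum_bounded_above block_bound_mono) auto
  also have "\<dots> \<le> real M * block_bound M"
    using block_bound_nonneg by (intro mult_right_mono) auto
  also have "real (ang2 s v (real (r i))) \<le> 2 * real (ang s v)" by (rule ang2_le[OF r])
  also have "\<dots> \<le> 2 * (ang_const * exp (sqrt (real v)))"
    using ang_Suc_le[of v] ang_mono[of v "Suc v"] by simp
  also have "\<dots> \<le> 2 * (ang_const * exp (sqrt (real M) / 2))"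
  proof -
    have "real (4 * v) \<le> real M" unfolding v_def by (intro of_nat_mono) simp
    then have "sqrt (real v) \<le> sqrt (real M / 4)" by (intro real_sqrt_le_mono) simp
    also have "\<dots> = sqrt (real M) / 2" by (simp add: real_sqrt_divide)
    finally show ?thesis using ang_const_ge by simp
  qed
  finally show ?thesis by (simp add: z_def)
qed

text \<open>Of the three error terms in the weak Erdos-Turan bound that do not involve Weyl sums, \<open>2\<delta>\<close>, \<open>1/(2P)\<close>
  and \<open>2/(P\<^sup>3\<delta>\<^sup>4)\<close>, the choice of \<open>\<delta> = 1/\<surd>M\<close> and \<open>P\<close> of the order of \<open>M\<close> makes the first \<open>2/\<surd>M\<close> and the
  others of order \<open>1/M\<close>.\<close>

lemma discrepancy_in_block:
  assumes i: "i \<ge> 1" and M: "16 \<le> M" "4 * max i (m0 (r i)) \<le> M"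
    and N: "ang2 s M (real (r i)) \<le> N" "N \<le> ang2 s (Suc M) (real (r i))"
    and pos: "ang2 s M (real (r i)) > 0"
  defines "W \<equiv> 2 * ang_const * exp (sqrt (real M) / 2) + real M * block_bound M"
  shows "discrepancy (\<lambda>n. frac (real (r i) ^ n * schmidt_number r s m0)) N \<le>
    2 * ((8202 / sqrt (real M)) + (real M * W + real (N - ang2 s M (real (r i)))) / real (ang2 s M (real (r i))))"
proof -
  define x where "x n = frac (real (r i) ^ n * schmidt_number r s m0)" for n
  define N' where "N' = ang2 s M (real (r i))"
  define P where "P = M div 8"
  define \<delta> where "\<delta> = 1 / sqrt (real M)"
  have sM: "sqrt (real M) > 0" using M by simp
  have P: "P > 0" "real M \<le> 16 * real P" "2 * real P \<le> real M" using M(1) by (auto simp: P_def)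
  have \<delta>: "\<delta> > 0" using sM by (simp add: \<delta>_def)
  have W0: "W \<ge> 0" using ang_const_ge block_bound_nonneg by (simp add: W_def)
  have weyl: "cmod (\<Sum>n\<in>{1..N'}. unit_exp (of_int h * x n)) \<le> W" if h: "h \<noteq> 0" "\<bar>h\<bar> < int (2 * P)" for h :: int
  proof -
    have "unit_exp (of_int h * x n) = unit_exp (real (r i) ^ n * of_int h * schmidt_number r s m0)" for n
      by (simp add: x_def unit_exp_frac mult_ac)
    moreover have "4 * \<bar>h\<bar> \<le> int M" using h by (simp add: P_def)
    ultimately show ?thesis
      unfolding W_def N'_def using weyl_sum_le[OF i M(2) h(1)] by simp
  qed
  define R where "R = real N' * (2 * \<delta> + 1 / real (2 * P)) + 2 * real P * W + 2 * real N' / (real P ^ 3 * \<delta> ^ 4) + real (N - N')"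
  have N0: "N > 0" "N' > 0" "N' \<le> N" using N(1) pos by (auto simp: N'_def)
  have "discrepancy x N \<le> 2 * R / real N"
  proof (rule discrepancy_le_one_sided)
    show "x n \<in> {0..<1}" for n by (simp add: x_def frac_lt_1)
    show "N > 0" by (fact N0)
    fix a b :: real assume ab: "0 \<le> a" "a \<le> b" "b \<le> 1"
    have "{n\<in>{1..N}. x n \<in> {a..b}} \<subseteq> {n\<in>{1..N'}. x n \<in> {a..b}} \<union> {N'<..N}" by auto
    then have "card {n\<in>{1..N}. x n \<in> {a..b}} \<le> card ({n\<in>{1..N'}. x n \<in> {a..b}} \<union> {N'<..N})"
      by (intro card_mono) auto
    also have "\<dots> \<le> card {n\<in>{1..N'}. x n \<in> {a..b}} + card {N'<..N}" by (rule card_Un_le)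
    finally have "real (card {n\<in>{1..N}. x n \<in> {a..b}}) \<le> real (card {n\<in>{1..N'}. x n \<in> {a..b}}) + real (N - N')"
      by simp
    moreover have "real (card {n\<in>{1..N'}. x n \<in> {a..b}}) \<le>
        real (card {1..N'}) * (b - a + 2 * \<delta> + 1 / real (2 * P)) + 2 * real P * W
          + 2 * real (card {1..N'}) / (real P ^ 3 * \<delta> ^ 4)"
      by (rule card_interval_le_weyl_sums) (use P \<delta> ab weyl W0 in auto)
    moreover have "real N' * (b - a) \<le> real N * (b - a)"
      using N0 ab by (intro mult_right_mono) auto
    ultimately show "real (card {n\<in>{1..N}. x n \<in> {a..b}}) \<le> real N * (b - a) + R"
      by (simp add: R_def algebra_simps)
  qed
  also have "\<dots> \<le> 2 * R / real N'"
    using N0 W0 \<delta> by (intro divide_left_mono) (auto simp: R_def)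
  also have "\<dots> = 2 * (2 * \<delta> + 1 / real (2 * P) + 2 / (real P ^ 3 * \<delta> ^ 4) + (2 * real P * W + real (N - N')) / real N')"
    using N0 by (simp add: R_def field_simps)
  also have "\<dots> \<le> 2 * (2 / sqrt (real M) + 8 / sqrt (real M) + 8192 / sqrt (real M) + (real M * W + real (N - N')) / real N')"
  proof (intro mult_left_mono add_mono divide_right_mono mult_right_mono)
    have sq: "sqrt (real M) \<le> real M"
      using M(1) by (intro real_le_lsqrt) (auto simp: power2_eq_square mult_le_cancel_left1)
    have "1 / real (2 * P) \<le> 8 / real M" using P M(1) by (simp add: field_simps)
    also have "\<dots> \<le> 8 / sqrt (real M)" using sq sM M(1) by (intro divide_left_mono) auto
    finally show "1 / real (2 * P) \<le> 8 / sqrt (real M)" .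
    have "\<delta> ^ 4 = 1 / (real M ^ 2)"
      using power_mult[of "sqrt (real M)" 2 2] by (simp add: \<delta>_def power_divide)
    then have "2 / (real P ^ 3 * \<delta> ^ 4) = 2 * real M ^ 2 / real P ^ 3" by simp
    also have "\<dots> \<le> 2 * real M ^ 2 / (real M / 16) ^ 3"
      using P M(1) by (intro divide_left_mono power_mono) auto
    also have "\<dots> = 8192 / real M" using M(1) by (simp add: power2_eq_square power3_eq_cube)
    also have "\<dots> \<le> 8192 / sqrt (real M)" using sq sM M(1) by (intro divide_left_mono) auto
    finally show "2 / (real P ^ 3 * \<delta> ^ 4) \<le> 8192 / sqrt (real M)" .
  qed (use P W0 in \<open>auto simp: \<delta>_def\<close>)
  finally show ?thesis by (simp add: x_def [abs_def] N'_def)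
qed

text \<open>In block number \<open>M\<close> every error is at most a constant times \<open>1 / \<surd>M\<close>, and \<open>ln N \<le> 2 \<surd>M\<close> there, since the
  block ends before a constant times \<open>exp \<surd>M\<close>.\<close>

theorem discrepancy_bound:
  assumes i: "i \<ge> 1"
  shows "\<exists>C>0. \<exists>N0. \<forall>N\<ge>N0. discrepancy (\<lambda>n. frac (real (r i) ^ n * schmidt_number r s m0)) N
    \<le> C * (ln (ln (real N)) / ln (real N))"
proof -
  define q where "q = real (r i)"
  define L where "L = ln q"
  have q: "q \<ge> 2" using r_ge[OF i] by (simp add: q_def)
  have L: "L > 0" using q by (simp add: L_def)
  define K where "K = 16404 + 8 * (1 + L)"
  have K: "K > 0" using L by (simp add: K_def)
  have "eventually (\<lambda>M. M \<ge> 16 + 4 * max i (m0 (r i))) sequentially"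
    by (rule eventually_ge_at_top)
  moreover have "eventually (\<lambda>M. real M * (2 * ang_const * exp (sqrt (real M) / 2) + real M * block_bound M)
      \<le> exp (sqrt (real M)) / sqrt (real M)) sequentially"
    using eventually_weyl_negligible[of "b0 / 2"] b0 unfolding block_bound_def by simp
  moreover have "eventually (\<lambda>M. (exp (sqrt (real M + 1)) + 2 * real (s 1) * (real M + 1) ^ 3) -
      (exp (sqrt (real M)) + 2 * real (s 1) * real M ^ 3) + 2 \<le> exp (sqrt (real M)) / sqrt (real M)) sequentially"
    using s1 by (intro eventually_block_length_le) simp
  moreover have "eventually (\<lambda>M. exp (sqrt (real M)) \<ge> 54 * L) sequentially"
    by (rule eventually_sequentially_of_real) real_asymp
  moreover have "eventually (\<lambda>M. ln (2 * ang_const) \<le> sqrt (real M)) sequentially"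
    using sqrt_at_top by (intro eventually_sequentially_of_real) (simp add: filterlim_at_top)
  ultimately have "eventually (\<lambda>M. \<forall>N. ang2 s M q \<le> N \<longrightarrow> N < ang2 s (Suc M) q \<longrightarrow>
      discrepancy (\<lambda>n. frac (q ^ n * schmidt_number r s m0)) N \<le> (2 * K) * (ln (ln (real N)) / ln (real N))) sequentially"
  proof eventually_elim
    case (elim M)
    show ?case
    proof (intro allI impI)
      fix N assume N: "ang2 s M q \<le> N" "N < ang2 s (Suc M) q"
      define E where "E = exp (sqrt (real M))"
      define N' where "N' = ang2 s M q"
      have M: "16 \<le> M" "4 * max i (m0 (r i)) \<le> M" using elim(1) by auto
      have sM: "sqrt (real M) > 0" using M by simp
      have E0: "E > 0" by (simp add: E_def)
      have "1 \<le> 2 * real (s 1) * real M ^ 3"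
        using mult_mono[of 1 "2 * real (s 1)" 1 "real M ^ 3"] s1 M(1) by auto
      then have angE: "E \<le> real (ang s M)"
        using ang_bounds(2)[of M s] by (simp add: E_def)
      have N'lo: "E / (2 * L) \<le> real N'" "27 \<le> E / (2 * L)"
      proof -
        show ge: "27 \<le> E / (2 * L)" using elim(4) L by (simp add: E_def field_simps)
        have "E / L \<le> real (ang s M) / L" using angE L by (simp add: divide_right_mono)
        also have "\<dots> < real N' + 1" unfolding L_def N'_def using q by (intro ang2_bounds) auto
        finally have "2 * (E / (2 * L)) < real N' + 1" by simp
        then show "E / (2 * L) \<le> real N'" using ge by linarith
      qed
      have N'0: "N' > 0" using N'lo by linarith
      have len: "real (N - N') \<le> (1 / L + 1) * (E / sqrt (real M))"
      proof -
        have "real N \<le> real (ang2 s (Suc M) q)" using N by simp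
        also have "\<dots> \<le> real (ang s (Suc M)) / L" unfolding L_def using q by (intro ang2_bounds) auto
        finally have "real N \<le> real (ang s (Suc M)) / L" .
        moreover have "real (ang s M) / L < real N' + 1"
          unfolding L_def N'_def using q by (intro ang2_bounds) auto
        moreover have "real (ang s (Suc M)) / L - real (ang s M) / L = (1 / L) * (real (ang s (Suc M)) - real (ang s M))"
          by (simp add: diff_divide_distrib)
        ultimately have "real (N - N') \<le> (1 / L) * (real (ang s (Suc M)) - real (ang s M)) + 1"
          using N by (simp add: N'_def of_nat_diff)
        also have "\<dots> \<le> (1 / L) * (E / sqrt (real M)) + E / sqrt (real M)"
        proof (intro add_mono mult_left_mono)
          show d: "real (ang s (Suc M)) - real (ang s M) \<le> E / sqrt (real M)"
            using ang_bounds(1)[of s "Suc M"] ang_bounds(2)[of M s] elim(3) by (simp add: E_def add.commute)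
          then show "1 \<le> E / sqrt (real M)" using ang_step[of M] by linarith
        qed (use L in simp)
        finally show ?thesis by (simp only: distrib_right mult_1_left)
      qed
      have quotient: "(E / sqrt (real M) + (1 / L + 1) * (E / sqrt (real M))) / (E / (2 * L)) = (4 * L + 2) / sqrt (real M)"
      proof -
        have "(E / w + (1 / L + 1) * (E / w)) / (E / (2 * L)) = (4 * L + 2) / w" for w
        proof -
          have "E / w + (1 / L + 1) * (E / w) = (2 + 1 / L) * (E / w)"
            by (simp only: distrib_right mult_1_left)
          also have "2 + 1 / L = (4 * L + 2) / (2 * L)" using L by (simp add: add_divide_distrib)
          also have "(4 * L + 2) / (2 * L) * (E / w) = (4 * L + 2) / w * (E / (2 * L))" by simp
          finally show ?thesis using E0 L by (simp only: nonzero_mult_div_cancel_right) auto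
        qed
        then show ?thesis .
      qed
      have "discrepancy (\<lambda>n. frac (q ^ n * schmidt_number r s m0)) N \<le>
        2 * ((8202 / sqrt (real M)) + (real M * (2 * ang_const * exp (sqrt (real M) / 2) + real M * block_bound M)
           + real (N - N')) / real N')"
        unfolding q_def N'_def using N N'0
        by (intro discrepancy_in_block i M) (auto simp: q_def N'_def)
      also have "\<dots> \<le> 2 * ((8202 / sqrt (real M)) + (E / sqrt (real M) + (1 / L + 1) * (E / sqrt (real M))) / (E / (2 * L)))"
        using N'lo len elim(2) N'0 E0 L sM
        by (intro mult_left_mono add_mono frac_le order_refl) (auto simp: E_def)
      also have "\<dots> = 2 * (8202 / sqrt (real M) + (4 * L + 2) / sqrt (real M))"
        by (simp only: quotient)
      also have "\<dots> = (16404 + 4 + 8 * L) / sqrt (real M)"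
        by (simp add: add_divide_distrib)
      also have "\<dots> \<le> K / sqrt (real M)"
        using sM by (intro divide_right_mono) (auto simp: K_def)
      finally have D: "discrepancy (\<lambda>n. frac (q ^ n * schmidt_number r s m0)) N \<le> K / sqrt (real M)" by simp
      \<comment> \<open>The bound \<open>27 = 3\<^sup>3\<close> ensures \<open>ln (ln N) \<ge> 1\<close>, since \<open>exp 1 \<le> 3\<close>.\<close>
      have N16: "real N \<ge> 27" using N'lo N by (simp add: N'_def) 
      have lnN1: "1 \<le> ln (ln (real N))"
      proof -
        have "exp (exp 1) \<le> exp (real 3 * 1)" using exp_le by simp
        also have "\<dots> = exp 1 ^ 3" by (rule exp_of_nat_mult)
        also have "\<dots> \<le> 3 ^ 3" using exp_le by (intro power_mono) auto
        finally have "exp 1 \<le> ln (real N)" using N16 by (subst ln_ge_iff) auto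
        then show ?thesis by (subst ln_ge_iff) (auto intro: less_le_trans[OF exp_gt_zero])
      qed
      have lnN0: "ln (real N) > 0" using N16 by simp
      have "real N \<le> 2 * real (ang s (Suc M))"
        using N ang2_le[OF q, of "Suc M"] by simp
      also have "\<dots> \<le> 2 * ang_const * E"
        using ang_Suc_le[of M] by (simp add: E_def)
      finally have "ln (real N) \<le> ln (2 * ang_const * E)"
        using N16 by (intro ln_mono) auto
      also have "\<dots> = ln (2 * ang_const) + sqrt (real M)"
        using ang_const_ge by (subst ln_mult) (auto simp: E_def)
      also have "\<dots> \<le> 2 * sqrt (real M)" using elim(5) by simp
      finally have "1 / sqrt (real M) \<le> 2 / ln (real N)"
        using lnN0 sM by (simp add: field_simps)
      also have "\<dots> \<le> 2 * (ln (ln (real N)) / ln (real N))"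
        using lnN1 lnN0 by (simp add: field_simps)
      finally have "K * (1 / sqrt (real M)) \<le> K * (2 * (ln (ln (real N)) / ln (real N)))"
        using K by (intro mult_left_mono) auto
      then show "discrepancy (\<lambda>n. frac (q ^ n * schmidt_number r s m0)) N \<le> (2 * K) * (ln (ln (real N)) / ln (real N))"
        using D by (simp add: mult_ac)
    qed
  qed
  then obtain M0 where M0: "\<And>M N. M \<ge> M0 \<Longrightarrow> ang2 s M q \<le> N \<Longrightarrow> N < ang2 s (Suc M) q \<Longrightarrow>
      discrepancy (\<lambda>n. frac (q ^ n * schmidt_number r s m0)) N \<le> (2 * K) * (ln (ln (real N)) / ln (real N))"
    by (auto simp: eventually_sequentially)
  have "discrepancy (\<lambda>n. frac (q ^ n * schmidt_number r s m0)) N \<le> (2 * K) * (ln (ln (real N)) / ln (real N))"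
    if N: "N \<ge> ang2 s M0 q" for N
  proof -
    have "\<exists>m. N < ang2 s m q"
    proof -
      have twice: "2 * real m \<le> real (ang s m)" for m
      proof (induction m)
        case (Suc m)
        then show ?case using ang_step[of m] by simp
      qed simp
      obtain m :: nat where "real m > L * (real N + 1)" using reals_Archimedean2 by blast
      then have "L * (real N + 1) < real (ang s m)"
        using twice[of m] by linarith
      then have "real N + 1 < real (ang s m) / L" using L by (simp add: field_simps)
      also have "\<dots> < real (ang2 s m q) + 1" unfolding L_def using q by (intro ang2_bounds) auto
      finally show ?thesis by auto
    qed
    then obtain m where m: "N < ang2 s m q" "\<And>k. k < m \<Longrightarrow> \<not> N < ang2 s k q"
      using exists_least_iff[of "\<lambda>m. N < ang2 s m q"] by blast
    have "m > M0"
    proof (rule ccontr)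
      assume "\<not> m > M0"
      then have "ang2 s m q \<le> ang2 s M0 q" using q by (intro ang2_mono) auto
      then show False using m(1) N by linarith
    qed
    then obtain M where M: "m = Suc M" "M \<ge> M0" by (cases m) auto
    show ?thesis
    proof (rule M0)
      show "ang2 s M q \<le> N" using m(2)[of M] M(1) by simp
    qed (use m(1) M in auto)
  qed
  then have "\<exists>N0. \<forall>N\<ge>N0. discrepancy (\<lambda>n. frac (q ^ n * schmidt_number r s m0)) N
      \<le> (2 * K) * (ln (ln (real N)) / ln (real N))"
    by blast
  moreover have "2 * K > 0" using K by simp
  ultimately show ?thesis unfolding q_def by blast
qed

end

section \<open>The modified sequences\<close>

lemma schmidt_const_mono:
  assumes "schmidt_const r s a" "0 < b" "b \<le> a"
  shows "schmidt_const r s b"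
  unfolding schmidt_const_def
proof (intro conjI allI impI)
  fix N K l :: nat assume *: "N > 0" "K > 0" "l > 0" "s ^ K \<le> l"
  have "(\<Sum>n<N. \<Prod>k. \<bar>cos (pi * real r ^ n * real l / real s ^ (K + 1 + k))\<bar>) \<le> 2 * real N powr (1 - a)"
    using assms(1) * unfolding schmidt_const_def by blast
  also have "\<dots> \<le> 2 * real N powr (1 - b)"
    using * assms by (intro mult_left_mono powr_mono) auto
  finally show "(\<Sum>n<N. \<Prod>k. \<bar>cos (pi * real r ^ n * real l / real s ^ (K + 1 + k))\<bar>) \<le> 2 * real N powr (1 - b)" .
qed (use assms in auto)

declare phi.simps(2) [simp del]

lemma finite_beta: "finite {\<beta> (i :: nat) (j :: nat) | i j. i \<in> {1..k} \<and> j \<in> {1..k}}"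
proof -
  have "{\<beta> i j | i j. i \<in> {1..k} \<and> j \<in> {1..k}} = (\<lambda>(i :: nat, j :: nat). \<beta> i j) ` ({1..k} \<times> {1..k})" by fastforce
  moreover have "finite \<dots>"
    by (intro finite_imageI finite_cartesian_product) auto
  ultimately show ?thesis by (rule ssubst)
qed

lemma beta_min_le: "i \<in> {1..k} \<Longrightarrow> j \<in> {1..k} \<Longrightarrow> beta_min \<beta> k \<le> \<beta> i j"
  unfolding beta_min_def by (intro Min_le finite_beta) blast

lemma beta_min_pos:
  assumes "\<And>i j. i \<ge> 1 \<Longrightarrow> j \<ge> 1 \<Longrightarrow> 0 < \<beta> i j" "k \<ge> 1"
  shows "0 < beta_min \<beta> k"
proof -
  have "beta_min \<beta> k \<in> {\<beta> i j | i j. i \<in> {1..k} \<and> j \<in> {1..k}}"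
    unfolding beta_min_def using assms(2) by (intro Min_in finite_beta) auto
  then show ?thesis using assms(1) by auto
qed

lemma s_le_gamma_max: "j \<in> {1..k} \<Longrightarrow> s j \<le> gamma_max s k"
  unfolding gamma_max_def by (intro Max_ge) auto

text \<open>The conditions on a value \<open>p\<close> of \<open>\<phi>\<close> at \<open>k\<close> that do not refer to the value at \<open>k - 1\<close>.\<close>

definition admissible :: "(nat \<Rightarrow> nat) \<Rightarrow> (nat \<Rightarrow> nat \<Rightarrow> real) \<Rightarrow> nat \<Rightarrow> nat \<Rightarrow> bool" where
  "admissible s \<beta> k p \<longleftrightarrow> 1 \<le> p \<and> beta_min \<beta> p \<ge> beta_min \<beta> 1 / real k powr (1 / 4)
     \<and> gamma_max s p \<le> gamma_max s 1 * k"

text \<open>The conditions become weaker as \<open>k\<close> grows, so the value of \<open>\<phi>\<close> at \<open>k\<close> remains a candidate at \<open>k + 1\<close>.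
  Hence the maximum that defines \<open>\<phi>\<close> is taken over a nonempty set and \<open>\<phi>\<close> does not decrease.\<close>

lemma phi_step:
  assumes pos: "0 < beta_min \<beta> 1" and k: "k \<ge> 1"
  shows "admissible s \<beta> k (phi s \<beta> k) \<and> phi s \<beta> k \<le> phi s \<beta> (Suc k) \<and> phi s \<beta> (Suc k) \<le> phi s \<beta> k + 1 \<and>
    (\<forall>p. p \<le> phi s \<beta> k + 1 \<longrightarrow> admissible s \<beta> (Suc k) p \<longrightarrow> p \<le> phi s \<beta> (Suc k))"
proof -
  let ?Q = "\<lambda>k p. 1 \<le> p \<and> p \<le> phi s \<beta> k + 1
             \<and> beta_min \<beta> p \<ge> beta_min \<beta> 1 / real (Suc k) powr (1 / 4)
             \<and> gamma_max s p \<le> gamma_max s 1 * Suc k"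
  have Q: "?Q k p \<longleftrightarrow> p \<le> phi s \<beta> k + 1 \<and> admissible s \<beta> (Suc k) p" for k p
    by (auto simp: admissible_def)
  have weaken: "admissible s \<beta> (Suc k) p" if "admissible s \<beta> k p" "k \<ge> 1" for k p
  proof -
    have "beta_min \<beta> 1 / real (Suc k) powr (1 / 4) \<le> beta_min \<beta> 1 / real k powr (1 / 4)"
      using pos that(2) by (intro divide_left_mono powr_mono2) auto
    moreover have "gamma_max s 1 * k \<le> gamma_max s 1 * Suc k" by (rule mult_le_mono2) simp
    ultimately show ?thesis using that(1) unfolding admissible_def by (meson le_trans order_trans)
  qed
  have phi_Suc: "phi s \<beta> (Suc k) = (GREATEST p. ?Q k p)" if "k \<ge> 1" for k using that by (simp add: phi.simps(2))
  have greatest: "?Q k (phi s \<beta> (Suc k))" "?Q k p \<Longrightarrow> p \<le> phi s \<beta> (Suc k)"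
    if "k \<ge> 1" "admissible s \<beta> k (phi s \<beta> k)" for k p
  proof -
    have "?Q k (phi s \<beta> k)" unfolding Q using weaken that by simp
    then show "?Q k (phi s \<beta> (Suc k))"
      unfolding phi_Suc[OF that(1)] by (rule GreatestI_nat[where P = "?Q k" and b = "phi s \<beta> k + 1"]) blast
    show "?Q k p \<Longrightarrow> p \<le> phi s \<beta> (Suc k)"
      unfolding phi_Suc[OF that(1)] by (rule Greatest_le_nat[where P = "?Q k" and b = "phi s \<beta> k + 1"]) auto
  qed
  have adm: "admissible s \<beta> k (phi s \<beta> k)"
    using k
  proof (induction k rule: dec_induct)
    case base
    show ?case by (simp add: admissible_def phi.simps(2))
  next
    case (step n)
    then show ?case using greatest(1)[of n] unfolding Q by blast
  qed
  then show ?thesis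
    using greatest[OF k adm] weaken[OF adm k] unfolding Q by (meson le_add1)
qed

lemma eventually_admissible:
  assumes "0 < beta_min \<beta> p" "p \<ge> 1" "gamma_max s 1 \<ge> 1"
  shows "eventually (\<lambda>k. admissible s \<beta> k p) sequentially"
proof -
  have "((\<lambda>x::real. c / x powr (1 / 4)) \<longlongrightarrow> 0) at_top" for c :: real by real_asymp
  then have "eventually (\<lambda>x::real. beta_min \<beta> 1 / x powr (1 / 4) < beta_min \<beta> p) at_top"
    using assms(1) by (rule order_tendstoD)
  then have "eventually (\<lambda>k. beta_min \<beta> 1 / real k powr (1 / 4) < beta_min \<beta> p) sequentially"
    by (rule eventually_sequentially_of_real)
  moreover have "eventually (\<lambda>k. gamma_max s p \<le> k) sequentially" by (rule eventually_ge_at_top)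
  ultimately show ?thesis
  proof eventually_elim
    case (elim k)
    have "1 * k \<le> gamma_max s 1 * k" using assms(3) by (rule mult_le_mono1)
    then have "gamma_max s p \<le> gamma_max s 1 * k" using elim(2) by linarith
    then show ?case using elim(1) assms(2) by (simp add: admissible_def)
  qed
qed

text \<open>If the value \<open>p + 1\<close> were skipped, \<open>\<phi>\<close> would be constant from some point on, but \<open>p + 1\<close> becomes
  admissible eventually.\<close>

lemma phi_surj:
  assumes pos: "\<And>i j. i \<ge> 1 \<Longrightarrow> j \<ge> 1 \<Longrightarrow> 0 < \<beta> i j" and \<gamma>: "gamma_max s 1 \<ge> 1" and "p \<ge> 1"
  shows "\<exists>k\<ge>1. phi s \<beta> k = p"
  using \<open>p \<ge> 1\<close>
proof (induction p rule: dec_induct)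
  case base
  show ?case by (intro exI[of _ 1]) (simp add: phi.simps(2))
next
  case (step p)
  then obtain k0 where k0: "k0 \<ge> 1" "phi s \<beta> k0 = p" by blast
  have pos1: "0 < beta_min \<beta> 1" by (rule beta_min_pos[OF pos]) auto
  show ?case
  proof (rule ccontr)
    assume no: "\<not> ?thesis"
    have const: "phi s \<beta> k = p" if "k \<ge> k0" for k
      using that
    proof (induction k rule: dec_induct)
      case (step k)
      then have "p \<le> phi s \<beta> (Suc k)" "phi s \<beta> (Suc k) \<le> p + 1"
        using phi_step[OF pos1, of k] k0 by auto
      moreover have "phi s \<beta> (Suc k) \<noteq> Suc p" using no by auto
      ultimately show ?case by simp
    qed (fact k0)
    have "eventually (\<lambda>k. admissible s \<beta> k (Suc p)) sequentially"
    proof (rule eventually_admissible)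
      show "0 < beta_min \<beta> (Suc p)" by (rule beta_min_pos[OF pos]) auto
    qed (use \<gamma> in auto)
    then obtain k1 where "\<And>k. k \<ge> k1 \<Longrightarrow> admissible s \<beta> k (Suc p)"
      by (auto simp: eventually_sequentially)
    then have "admissible s \<beta> (Suc (max k0 k1)) (Suc p)" by simp
    then have "Suc p \<le> phi s \<beta> (Suc (max k0 k1))"
      using phi_step[OF pos1, of "max k0 k1" s] const[of "max k0 k1"] k0 by auto
    then show False using const[of "Suc (max k0 k1)"] by simp
  qed
qed

theorem theorem2p4:
  fixes s :: "nat \<Rightarrow> nat" and a20 :: "nat \<Rightarrow> nat \<Rightarrow> real"
    and \<beta> :: "nat \<Rightarrow> nat \<Rightarrow> real" and m0 :: "nat \<Rightarrow> nat" and r :: nat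
  assumes "\<And>p q. p > 1 \<Longrightarrow> q > 1 \<Longrightarrow> \<not> mult_dep p q \<Longrightarrow> schmidt_const p q (a20 p q)"
    and "\<And>j. j \<ge> 1 \<Longrightarrow> s j > 2"
    and "\<And>m. m \<ge> 1 \<Longrightarrow> s m \<le> m * s 1"
    and "\<And>p. p \<ge> 2 \<Longrightarrow> \<exists>M\<ge>1. \<forall>m\<ge>M. \<not> mult_dep p (s m)"
    and "\<And>i j. i \<ge> 1 \<Longrightarrow> j \<ge> 1 \<Longrightarrow> \<not> mult_dep (base_seq i) (s j) \<Longrightarrow>
           \<beta> i j = a20 (base_seq i) (s j)"
    and "\<And>i j. i \<ge> 1 \<Longrightarrow> j \<ge> 1 \<Longrightarrow> 0 < \<beta> i j \<and> \<beta> i j < 1 / 2"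
    and "\<And>i. i \<ge> 1 \<Longrightarrow> m0 (mod_r s \<beta> i) \<ge> 1 \<and>
           (\<forall>m\<ge>m0 (mod_r s \<beta> i). \<not> mult_dep (mod_r s \<beta> i) (mod_s s \<beta> m))"
    and "r \<ge> 2"
  shows "\<exists>C>0. \<exists>N0. \<forall>N\<ge>N0.
           discrepancy (\<lambda>n. frac (real r ^ n * schmidt_number (mod_r s \<beta>) (mod_s s \<beta>) m0)) N
             \<le> C * (ln (ln (real N)) / ln (real N))"
proof -
  have pos: "0 < \<beta> i j" if "i \<ge> 1" "j \<ge> 1" for i j using assms(6) that by blast
  have pos1: "0 < beta_min \<beta> 1" by (rule beta_min_pos[OF pos]) auto
  have s1_gt: "s 1 > 2" using assms(2) by simp
  have \<gamma>: "gamma_max s 1 = s 1" using s1_gt by (simp add: gamma_max_def base_seq_def max_def)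
  have phi_1: "phi s \<beta> 1 = 1" by (simp add: phi.simps(2))
  have phi_1: "phi s \<beta> 1 = 1" by (simp add: phi.simps(2))
  have phi_1: "phi s \<beta> 1 = 1" by (simp add: phi.simps(2))
  have phi_1: "phi s \<beta> 1 = 1" by (simp add: phi.simps(2))
  have adm: "admissible s \<beta> k (phi s \<beta> k)" if "k \<ge> 1" for k
    using phi_step[OF pos1 that] by blast
  have phi1: "phi s \<beta> k \<ge> 1" if "k \<ge> 1" for k
    using adm[OF that] by (simp add: admissible_def)
  have mono: "phi s \<beta> i \<le> phi s \<beta> m" if "1 \<le> i" "i \<le> m" for i m
    using that(2)
  proof (induction m rule: dec_induct)
    case (step m)
    then show ?case using phi_step[OF pos1, of m s] that(1) by auto
  qed simp
  interpret schmidt_construction "mod_r s \<beta>" "mod_s s \<beta>" m0 "beta_min \<beta> 1"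
  proof
    show "mod_s s \<beta> m \<ge> 3" if "m \<ge> 1" for m
      using assms(2)[OF phi1[OF that]] by (simp add: mod_s_def)
    show "mod_s s \<beta> m \<le> m * mod_s s \<beta> 1" if "m \<ge> 1" for m
    proof -
      have "s (phi s \<beta> m) \<le> gamma_max s (phi s \<beta> m)"
        using phi1[OF that] by (intro s_le_gamma_max) simp
      also have "\<dots> \<le> s 1 * m" using adm[OF that] \<gamma> unfolding admissible_def by simp
      finally show ?thesis by (simp add: mod_s_def phi_1 [unfolded One_nat_def] mult.commute)
    qed
    show "mod_r s \<beta> i \<ge> 2" if "i \<ge> 1" for i
      using phi1[OF that] by (simp add: mod_r_def base_seq_def)
    show "0 < beta_min \<beta> 1" by (fact pos1)
    show "beta_min \<beta> 1 \<le> 1"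
      using beta_min_le[of 1 1 1 \<beta>] assms(6)[of 1 1] by simp
    show "schmidt_const (mod_r s \<beta> i) (mod_s s \<beta> m) (beta_min \<beta> 1 / real m powr (1 / 4))"
      if "1 \<le> i" "i \<le> m" "m0 (mod_r s \<beta> i) \<le> m" for i m
    proof (rule schmidt_const_mono)
      have m: "m \<ge> 1" using that by simp
      have nd: "\<not> mult_dep (mod_r s \<beta> i) (mod_s s \<beta> m)" using assms(7) that by blast
      then have eq: "\<beta> (phi s \<beta> i) (phi s \<beta> m) = a20 (mod_r s \<beta> i) (mod_s s \<beta> m)"
        unfolding mod_r_def mod_s_def using phi1 that m by (intro assms(5)) auto
      show "schmidt_const (mod_r s \<beta> i) (mod_s s \<beta> m) (\<beta> (phi s \<beta> i) (phi s \<beta> m))"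
        unfolding eq
      proof (rule assms(1)[OF _ _ nd])
        show "mod_r s \<beta> i > 1" using phi1 that by (simp add: mod_r_def base_seq_def Suc_le_eq)
        show "mod_s s \<beta> m > 1" using assms(2)[OF phi1[OF m]] by (simp add: mod_s_def)
      qed
      have "beta_min \<beta> 1 / real m powr (1 / 4) \<le> beta_min \<beta> (phi s \<beta> m)"
        using adm[OF m] by (simp add: admissible_def)
      also have "\<dots> \<le> \<beta> (phi s \<beta> i) (phi s \<beta> m)"
        using phi1 that m mono by (intro beta_min_le) auto
      finally show "beta_min \<beta> 1 / real m powr (1 / 4) \<le> \<beta> (phi s \<beta> i) (phi s \<beta> m)" .
      show "0 < beta_min \<beta> 1 / real m powr (1 / 4)" using pos1 m by simp
    qed
  qed
  have "\<exists>i\<ge>1. phi s \<beta> i = r - 1"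
  proof (rule phi_surj)
    show "0 < \<beta> i j" if "i \<ge> 1" "j \<ge> 1" for i j by (rule pos[OF that])
  qed (use \<gamma> s1_gt assms(8) in auto)
  then obtain i where i: "i \<ge> 1" "phi s \<beta> i = r - 1" by blast
  then have "mod_r s \<beta> i = r" using assms(8) by (simp add: mod_r_def base_seq_def)
  with discrepancy_bound[OF i(1)] show ?thesis by simp
qed

end
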